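(* Let $\alpha\in\mathbb{R}$, $\alpha\neq -1$, let $T_*>0$, and let $V:\mathbb{R}^3\to\mathbb{R}^3$ be a vector field with vorticity $\Omega=\mathrm{curl}\,V$. Suppose there exists $p_1>0$ such that $\Omega\in L^p(\mathbb{R}^3;\mathbb{R}^3)$ for all $p\in(0,p_1)$. Then there is no finite time blowing up self-similar solution of the 3D incompressible Euler equations with profile $V$; that is, there is no solution $v$ of the Euler equations on $[0,T_* )$ of the form $$v(x,t)=\frac{1}{(T_*-t)^{\frac{\alpha}{\alpha+1}}}\,V\!\left(\frac{x}{(T_*-t)^{\frac{1}{\alpha+1}}}\right),\qquad x\in\mathbb{R}^3,\ t\in(0,T_* ),$$ that blows up at time $T_*$.
   Context: The 3D incompressible Euler equations are $$\frac{\partial v}{\partial t}+(v\cdot\nabla)v=-\nabla p,\qquad \mathrm{div}\,v=0,\qquad v(x,0)=v_0(x),$$ for the velocity $v=(v_1,v_2,v_3)(x,t)$ and a scalar pressure $p=p(x,t)$, $x\in\mathbb{R}^3$, with $\mathrm{div}\,v_0=0$. A solution on $[0,T_* )$ is understood to be a classical solution with $v\in C([0,T_* );C^1(\mathbb{R}^3;\mathbb{R}^3))$. Here this means that $v(\cdot,t)$ is $C^1$ in $x$ with bounded gradient, $v$ is continuous in $(x,t)$, and $t\mapsto\nabla v(\cdot,t)$ is continuous from $[0,T_* )$ into the bounded continuous functions with the sup norm. The velocity itself is not required to be bounded or to decay at infinity. Blow-up at $T_*$ is understood in terms of the vorticity: $v$ blows up at $T_*$ if $\sup_{t\in[0,T_*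 )}\|\mathrm{curl}\,v(\cdot,t)\|_{L^\infty(\mathbb{R}^3)}=\infty$. For $v$ of the form $v(x,t)=(T_*-t)^{-\frac{\alpha}{\alpha+1}}\,V\big(x/(T_*-t)^{1/(\alpha+1)}\big)$, $\mathrm{curl}\,v(x,t)=(T_*-t)^{-1}\Omega\big(x/(T_*-t)^{1/(\alpha+1)}\big)$, so this happens exactly when $\Omega\not\equiv 0$. For $0<p<1$, $\Omega\in L^p$ means that $\Omega$ is measurable and $\int|\Omega|^p\,dx<\infty$. *)

theory Defs
  imports "HOL-Analysis.Analysis" "HOL-Probability.Essential_Supremum"
begin

definition partial_deriv :: "3 \<Rightarrow> (real^3 \<Rightarrow> 'a::real_normed_vector) \<Rightarrow> real^3 \<Rightarrow> 'a" where
  "partial_deriv j f x = vector_derivative (\<lambda>s. f (x + s *\<^sub>R axis j 1)) (at 0)"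

definition grad :: "(real^3 \<Rightarrow> real) \<Rightarrow> real^3 \<Rightarrow> real^3" where
  "grad f x = (\<chi> j. partial_deriv j f x)"

definition divergence :: "(real^3 \<Rightarrow> real^3) \<Rightarrow> real^3 \<Rightarrow> real" where
  "divergence u x = (\<Sum>j\<in>UNIV. partial_deriv j (\<lambda>y. u y $ j) x)"

definition curl :: "(real^3 \<Rightarrow> real^3) \<Rightarrow> real^3 \<Rightarrow> real^3" where
  "curl u x = vector
     [partial_deriv 2 (\<lambda>y. u y $ 3) x - partial_deriv 3 (\<lambda>y. u y $ 2) x,
      partial_deriv 3 (\<lambda>y. u y $ 1) x - partial_deriv 1 (\<lambda>y. u y $ 3) x,
      partial_deriv 1 (\<lambda>y. u y $ 2) x - partial_deriv 2 (\<lambda>y. u y $ 1) x]"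

text \<open>The convective term \<open>(u \<cdot> \<nabla>) w\<close>.\<close>

definition convective :: "(real^3 \<Rightarrow> real^3) \<Rightarrow> (real^3 \<Rightarrow> real^3) \<Rightarrow> real^3 \<Rightarrow> real^3" where
  "convective u w x = (\<Sum>j\<in>UNIV. (u x $ j) *\<^sub>R partial_deriv j w x)"

text \<open>The class \<open>C([0,T); C\<^sup>1)\<close>, without boundedness of the velocity itself. The type of \<open>G t\<close>
  consists of the bounded continuous functions with the sup norm, so its existence makes the
  spatial gradient bounded, continuous in \<open>x\<close>, and continuous in \<open>t\<close> uniformly in \<open>x\<close>.\<close>

definition continuous_into_C1 :: "real \<Rightarrow> (real^3 \<Rightarrow> real \<Rightarrow> real^3) \<Rightarrow> bool" where
  "continuous_into_C1 T v \<longleftrightarrow>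
     continuous_on (UNIV \<times> {0..<T}) (\<lambda>(x, t). v x t) \<and>
     (\<exists>G :: real \<Rightarrow> ((real^3) \<Rightarrow>\<^sub>C ((real^3) \<Rightarrow>\<^sub>L (real^3))).
        continuous_on {0..<T} G \<and>
        (\<forall>t\<in>{0..<T}. \<forall>x.
           ((\<lambda>y. v y t) has_derivative blinfun_apply (apply_bcontfun (G t) x)) (at x)))"

text \<open>Classical solutions on \<open>[0,T)\<close> with initial velocity \<open>v0\<close>. The momentum equation is imposed
  on the open time interval, where the time derivative is two-sided; the initial datum is attained
  through the continuity of \<open>v\<close> up to \<open>t = 0\<close>. No regularity of the pressure is required beyond
  differentiability in space.\<close>

definition euler_solution ::
  "real \<Rightarrow> (real^3 \<Rightarrow> real^3) \<Rightarrow> (real^3 \<Rightarrow> real \<Rightarrow> real^3) \<Rightarrow> (real^3 \<Rightarrow> real \<Rightarrow> real) \<Rightarrow> bool" where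
  "euler_solution T v0 v p \<longleftrightarrow>
     continuous_into_C1 T v \<and>
     (\<forall>t\<in>{0<..<T}. \<forall>x.
        (\<lambda>y. p y t) differentiable (at x) \<and>
        (\<lambda>s. v x s) differentiable (at t) \<and>
        vector_derivative (\<lambda>s. v x s) (at t) + convective (\<lambda>y. v y t) (\<lambda>y. v y t) x
          = - grad (\<lambda>y. p y t) x) \<and>
     (\<forall>t\<in>{0..<T}. \<forall>x. divergence (\<lambda>y. v y t) x = 0) \<and>
     (\<forall>x. v x 0 = v0 x) \<and>
     (\<forall>x. divergence v0 x = 0)"

definition blows_up_at :: "real \<Rightarrow> (real^3 \<Rightarrow> real \<Rightarrow> real^3) \<Rightarrow> bool" where
  "blows_up_at T v \<longleftrightarrow>
     (SUP t\<in>{0..<T}. esssup lebesgue (\<lambda>x. ennreal (norm (curl (\<lambda>y. v y t) x)))) = \<infinity>"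

text \<open>Membership in \<open>L\<^sup>p\<close> for real exponents \<open>p > 0\<close>, including \<open>p < 1\<close>.\<close>

definition in_Lp :: "real \<Rightarrow> (real^3 \<Rightarrow> real^3) \<Rightarrow> bool" where
  "in_Lp p f \<longleftrightarrow> f \<in> borel_measurable lebesgue \<and>
     (\<integral>\<^sup>+ x. ennreal (norm (f x) powr p) \<partial>lebesgue) < \<infinity>"

definition self_similar ::
  "real \<Rightarrow> real \<Rightarrow> (real^3 \<Rightarrow> real^3) \<Rightarrow> (real^3 \<Rightarrow> real \<Rightarrow> real^3) \<Rightarrow> bool" where
  "self_similar \<alpha> T V v \<longleftrightarrow>
     (\<forall>x. \<forall>t\<in>{0<..<T}.
        v x t = (1 / (T - t) powr (\<alpha> / (\<alpha> + 1))) *\<^sub>R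
                  V (x /\<^sub>R ((T - t) powr (1 / (\<alpha> + 1)))))"

end

theory Submission
  imports Defs
begin

text \<open>Put \<open>b = 1/(\<alpha>+1)\<close>, \<open>a = \<alpha>/(\<alpha>+1)\<close>, so that \<open>a + b = 1\<close>, and \<open>W(y) = V(y) + b y\<close>. In self-similar variables
  the vorticity equation is stationary, \<open>W \<cdot> \<nabla>\<Omega> = \<Omega> \<cdot> \<nabla>V - \<Omega>\<close>. Since \<open>\<nabla>V\<close> is bounded, \<open>|\<Omega>|\<close> varies along \<open>W\<close> at
  most at a fixed exponential rate \<open>C\<close>, whereas the flow of \<open>W\<close> multiplies volumes at the rate
  \<open>div W = 3b \<noteq> 0\<close>. Multiplying the equation by the derivative of \<open>|\<Omega>|\<^sup>p\<close> and integrating gives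
  \<open>3|b| \<integral>|\<Omega>|\<^sup>p \<le> p C \<integral>|\<Omega>|\<^sup>p\<close> with \<open>C\<close> independent of \<open>p\<close>. The integral is finite for all small \<open>p\<close>, so
  letting \<open>p\<close> be small forces it to vanish: \<open>\<Omega> = 0\<close>, and nothing blows up.

  Here \<open>\<Omega>\<close> is merely continuous and the equation for \<open>\<Omega>\<close> makes no pointwise sense. What does is the
  momentum equation, which the identity \<open>W \<cdot> \<nabla>V = \<omega>W + \<nabla>V\<^sup>T W\<close> brings to the form
  \<open>(a - b) V\<^sub>i + \<Sum>\<^sub>j W\<^sub>j \<omega>\<^sub>j\<^sub>i = - \<partial>\<^sub>i Q\<close> with \<open>\<omega>\<^sub>i\<^sub>j = \<partial>\<^sub>i V\<^sub>j - \<partial>\<^sub>j V\<^sub>i\<close>. All terms are continuous, so it can be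
  mollified and its curl taken on the kernel. The mollified vorticity is continuously differentiable, and
  its derivative along \<open>W\<close> converges boundedly to the expected right-hand side (a commutator estimate in the
  manner of DiPerna and Lions, lemma \<open>vorticity_approximation\<close>). This justifies the integrated equation for every
  \<open>G(|\<omega>|\<^sup>2)\<close> with a cutoff (\<open>renormalised_identity\<close>). Taking \<open>G(s) = (s + \<delta>)\<^sup>q - \<delta>\<^sup>q\<close> and cutoffs tending to \<open>1\<close>
  yields the inequality above (\<open>powr_integral_estimate\<close>). The cutoff error vanishes because \<open>W\<close> grows at most
  linearly. Writing the vorticity as the 2-form \<open>\<omega>\<close> makes the
  estimate valid in \<open>real^'n\<close>.\<close>

section \<open>Partial derivatives and integrals of compactly supported functions\<close>

text \<open>Being one-dimensional, this notion makes the product and chain rules instances of the rules for \<open>DERIV\<close>.\<close>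

definition has_partial :: "(real^'n \<Rightarrow> real) \<Rightarrow> 'n::finite \<Rightarrow> (real^'n \<Rightarrow> real) \<Rightarrow> bool" where
  "has_partial f i f' \<longleftrightarrow> (\<forall>x. ((\<lambda>s. f (x + s *\<^sub>R axis i 1)) has_real_derivative f' x) (at 0))"

definition zero_outside :: "real \<Rightarrow> (real^'n \<Rightarrow> real) \<Rightarrow> bool" where
  "zero_outside r f \<longleftrightarrow> (\<forall>x. norm x > r \<longrightarrow> f x = 0)"

lemma has_partialD:
  assumes "has_partial f i f'"
  shows "((\<lambda>s. f (x + s *\<^sub>R axis i 1)) has_real_derivative f' (x + s *\<^sub>R axis i 1)) (at s)"
proof -
  have "((\<lambda>h. f ((x + s *\<^sub>R axis i 1) + h *\<^sub>R axis i 1)) has_real_derivative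
          f' (x + s *\<^sub>R axis i 1)) (at 0)"
    using assms unfolding has_partial_def by blast
  then show ?thesis
    using DERIV_shift[of "\<lambda>h. f (x + h *\<^sub>R axis i 1)" "f' (x + s *\<^sub>R axis i 1)" 0 s]
    by (simp add: algebra_simps)
qed

lemma has_partial_mult:
  assumes "has_partial f i f'" "has_partial g i g'"
  shows "has_partial (\<lambda>x. f x * g x) i (\<lambda>x. f' x * g x + f x * g' x)"
  unfolding has_partial_def
proof
  fix x
  show "((\<lambda>s. f (x + s *\<^sub>R axis i 1) * g (x + s *\<^sub>R axis i 1)) has_real_derivative
      f' x * g x + f x * g' x) (at 0)"
    using DERIV_mult[OF has_partialD[OF assms(1), of x 0] has_partialD[OF assms(2), of x 0]]
    by (simp add: algebra_simps)
qed

lemma has_partial_add: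
  assumes "has_partial f i f'" "has_partial g i g'"
  shows "has_partial (\<lambda>x. f x + g x) i (\<lambda>x. f' x + g' x)"
  using assms unfolding has_partial_def by (auto intro!: DERIV_add)

lemma has_partial_cmult:
  assumes "has_partial f i f'"
  shows "has_partial (\<lambda>x. c * f x) i (\<lambda>x. c * f' x)"
  using assms unfolding has_partial_def by (auto intro!: DERIV_cmult)

lemma has_partial_sum:
  assumes "\<And>k. k \<in> A \<Longrightarrow> has_partial (f k) i (f' k)"
  shows "has_partial (\<lambda>x. \<Sum>k\<in>A. f k x) i (\<lambda>x. \<Sum>k\<in>A. f' k x)"
  using assms unfolding has_partial_def by (auto intro!: DERIV_sum)

lemma has_partial_compose:
  assumes "has_partial f i f'" and "\<And>x. (g has_real_derivative g' (f x)) (at (f x))"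
  shows "has_partial (\<lambda>x. g (f x)) i (\<lambda>x. g' (f x) * f' x)"
  unfolding has_partial_def
proof
  fix x
  show "((\<lambda>s. g (f (x + s *\<^sub>R axis i 1))) has_real_derivative g' (f x) * f' x) (at 0)"
    using DERIV_chain2[of g "g' (f x)" "\<lambda>s. f (x + s *\<^sub>R axis i 1)" 0] assms
    unfolding has_partial_def by simp
qed

lemma has_partial_coordinate: "has_partial (\<lambda>x. x $ l) i (\<lambda>x. if l = i then 1 else 0)"
  unfolding has_partial_def
  by (auto simp: axis_def intro!: derivative_eq_intros)

lemma has_partial_norm_square: "has_partial (\<lambda>x::real^'n. (norm x)\<^sup>2) i (\<lambda>x. 2 * x $ i)"
proof -
  have "(norm (x + s *\<^sub>R axis i 1))\<^sup>2 = (norm x)\<^sup>2 + 2 * s * x $ i + s\<^sup>2" for x :: "real^'n" and s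
    unfolding power2_norm_eq_inner
    by (simp add: inner_add_left inner_add_right inner_axis inner_axis' power2_eq_square algebra_simps)
  then show ?thesis
    unfolding has_partial_def by (auto intro!: derivative_eq_intros)
qed

lemma has_vector_derivative_along_axis:
  assumes "(f has_derivative f') (at x)"
  shows "((\<lambda>s. f (x + s *\<^sub>R axis i 1)) has_vector_derivative f' (axis i 1)) (at 0)"
proof -
  have "((\<lambda>s::real. x + s *\<^sub>R axis i 1) has_derivative (\<lambda>s. s *\<^sub>R axis i 1)) (at 0)"
    by (auto intro!: derivative_eq_intros)
  moreover have "(f has_derivative f') (at (x + 0 *\<^sub>R axis i 1))"
    using assms by simp
  ultimately have "((\<lambda>s. f (x + s *\<^sub>R axis i 1)) has_derivative (\<lambda>s. f' (s *\<^sub>R axis i 1))) (at 0)"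
    by (rule has_derivative_compose)
  moreover have "f' (s *\<^sub>R axis i 1) = s *\<^sub>R f' (axis i 1)" for s
    using has_derivative_linear[OF assms] by (simp add: linear_cmul)
  ultimately show ?thesis
    by (simp add: has_vector_derivative_def)
qed

lemma has_partial_component:
  fixes f :: "real^'n \<Rightarrow> real^'m"
  assumes "\<And>x. (f has_derivative f' x) (at x)"
  shows "has_partial (\<lambda>x. f x $ j) i (\<lambda>x. f' x (axis i 1) $ j)"
  unfolding has_partial_def has_real_derivative_iff_has_vector_derivative
  using bounded_linear.has_vector_derivative[OF bounded_linear_vec_nth
      has_vector_derivative_along_axis[OF assms]] by blast

text \<open>The region where the norm exceeds \<open>r\<close> is open, so \<open>f\<close> vanishes near each of its points.\<close>

lemma zero_outside_partial:
  fixes f :: "real^'n \<Rightarrow> real"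
  assumes "has_partial f i f'" "zero_outside r f"
  shows "zero_outside r f'"
  unfolding zero_outside_def
proof (intro allI impI)
  fix x :: "real^'n" assume x: "r < norm x"
  have "\<forall>\<^sub>F s in nhds 0. r < norm (x + s *\<^sub>R axis i 1)"
  proof (rule order_tendstoD(1))
    have "((\<lambda>s. norm (x + s *\<^sub>R axis i 1)) \<longlongrightarrow> norm (x + 0 *\<^sub>R axis i 1)) (nhds (0::real))"
      by (intro tendsto_intros filterlim_ident)
    then show "((\<lambda>s. norm (x + s *\<^sub>R axis i 1)) \<longlongrightarrow> norm x) (nhds (0::real))" by simp
  qed fact
  then have "\<forall>\<^sub>F s in nhds 0. f (x + s *\<^sub>R axis i 1) = 0"
    by eventually_elim (use assms(2) in \<open>auto simp: zero_outside_def\<close>)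
  then have "((\<lambda>s. f (x + s *\<^sub>R axis i 1)) has_real_derivative 0) (at 0)"
    by (subst DERIV_cong_ev[OF refl _ refl, where g = "\<lambda>_. 0"]) auto
  then show "f' x = 0"
    using assms(1) DERIV_unique unfolding has_partial_def by blast
qed

lemma norm_le_in_cbox: "norm x \<le> r \<Longrightarrow> x \<in> cbox (\<chi> i. - r) (\<chi> i. r)" for r :: real
proof -
  assume "norm x \<le> r"
  then have "\<bar>x $ i\<bar> \<le> r" for i
    using component_le_norm_cart[of x i] by linarith
  then have "- r \<le> x $ i \<and> x $ i \<le> r" for i
    by (simp add: abs_le_iff minus_le_iff)
  then show ?thesis by (simp add: mem_box_cart)
qed

text \<open>The link between the two integrals of the library: the Lebesgue integral is needed for dominated
  convergence, the gauge integral over a box for differentiation under the integral sign.\<close>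

lemma integral_zero_outside:
  fixes f :: "real^'n \<Rightarrow> real"
  assumes "continuous_on UNIV f" "zero_outside r f"
  shows "integrable lborel f"
    and "integral\<^sup>L lborel f = integral (cbox (\<chi> i. - r) (\<chi> i. r)) f"
    and "f integrable_on cbox (\<chi> i. - r) (\<chi> i. r)"
proof -
  let ?B = "cbox (\<chi> i. - r) (\<chi> i. r) :: (real^'n) set"
  have eq: "indicator ?B x *\<^sub>R f x = f x" for x
    using assms(2) norm_le_in_cbox[of x r] by (cases "norm x \<le> r") (auto simp: zero_outside_def)
  have "integrable lborel (\<lambda>x. indicator ?B x *\<^sub>R f x)"
    by (rule borel_integrable_compact) (auto intro: continuous_on_subset[OF assms(1)])
  then show "integrable lborel f" by (simp only: eq)
  have "set_integrable lborel ?B f"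
    unfolding set_integrable_def by fact
  from set_borel_integral_eq_integral[OF this]
  show "f integrable_on ?B" "integral\<^sup>L lborel f = integral ?B f"
    unfolding set_lebesgue_integral_def by (simp_all only: eq)
qed

lemma borel_measurable_lborel_continuous:
  fixes f :: "real^'n \<Rightarrow> real"
  assumes "continuous_on UNIV f"
  shows "f \<in> borel_measurable lborel"
  using borel_measurable_continuous_onI[OF assms] by simp

lemma integral_param_derivative:
  fixes F F' :: "real \<Rightarrow> real^'n \<Rightarrow> real"
  assumes d: "\<And>s y. ((\<lambda>s. F s y) has_real_derivative F' s y) (at s)"
    and c: "\<And>s. continuous_on UNIV (F s)"
    and c': "continuous_on UNIV (\<lambda>(s, y). F' s y)"
    and z: "\<And>s. \<bar>s\<bar> < 1 \<Longrightarrow> zero_outside r (F s)" "zero_outside r (F' 0)"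
  shows "((\<lambda>s. integral\<^sup>L lborel (F s)) has_real_derivative integral\<^sup>L lborel (F' 0)) (at 0)"
proof -
  let ?B = "cbox (\<chi> i. - r) (\<chi> i. r) :: (real^'n) set"
  have c0: "continuous_on UNIV (F' 0)"
    using continuous_on_compose2[OF c', of UNIV "\<lambda>y. (0, y)"]
    by (simp add: continuous_on_Pair continuous_on_const continuous_on_id)
  have "((\<lambda>s. integral ?B (F s)) has_real_derivative integral ?B (F' 0)) (at 0 within {-1<..<1})"
  proof (rule leibniz_rule_field_derivative)
    show "((\<lambda>s. F s y) has_real_derivative F' s y) (at s within {-1<..<1})" for s y
      using d by (rule has_field_derivative_at_within)
    show "F s integrable_on ?B" if "s \<in> {-1<..<1}" for s
      using that by (intro integral_zero_outside c z) auto
    show "continuous_on ({-1<..<1} \<times> ?B) (\<lambda>(s, y). F' s y)"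
      by (rule continuous_on_subset[OF c']) auto
  qed auto
  then have "((\<lambda>s. integral ?B (F s)) has_real_derivative integral ?B (F' 0)) (at 0)"
    by (subst (asm) at_within_open) auto
  then have "((\<lambda>s. integral ?B (F s)) has_real_derivative integral\<^sup>L lborel (F' 0)) (at 0)"
    using integral_zero_outside(2)[OF c0 z(2)] by simp
  moreover have "\<forall>\<^sub>F s in nhds 0. integral ?B (F s) = integral\<^sup>L lborel (F s)"
  proof -
    have "\<forall>\<^sub>F s in nhds (0::real). s \<in> {-1<..<1}"
      by (intro eventually_nhds_in_open) auto
    then show ?thesis
      by eventually_elim (intro integral_zero_outside(2)[symmetric] c z, auto)
  qed
  ultimately show ?thesis
    by (subst (asm) DERIV_cong_ev[OF refl _ refl]) auto
qed

text \<open>The integral of a translate of \<open>f\<close> does not depend on the translation; differentiate in the translation.\<close>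

lemma integral_partial_eq_0:
  fixes f :: "real^'n \<Rightarrow> real"
  assumes "has_partial f i f'" "continuous_on UNIV f" "continuous_on UNIV f'" "zero_outside r f"
  shows "integral\<^sup>L lborel f' = 0"
proof -
  let ?F = "\<lambda>s y. f (y + s *\<^sub>R axis i 1)" and ?F' = "\<lambda>s y. f' (y + s *\<^sub>R axis i 1)"
  have "((\<lambda>s. integral\<^sup>L lborel (?F s)) has_real_derivative integral\<^sup>L lborel (?F' 0)) (at 0)"
  proof (rule integral_param_derivative[where r = "r + 1"])
    show "((\<lambda>s. ?F s y) has_real_derivative ?F' s y) (at s)" for s y
      using has_partialD[OF assms(1)] .
    show "continuous_on UNIV (?F s)" for s
      by (intro continuous_on_compose2[OF assms(2)] continuous_intros) auto
    show "continuous_on UNIV (\<lambda>(s, y). ?F' s y)"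
      by (auto simp: case_prod_unfold intro!: continuous_on_compose2[OF assms(3)] continuous_intros)
    have "zero_outside r f'" by (rule zero_outside_partial[OF assms(1,4)])
    then show "zero_outside (r + 1) (?F' 0)"
      by (auto simp: zero_outside_def)
    show "zero_outside (r + 1) (?F s)" if "\<bar>s\<bar> < 1" for s
      unfolding zero_outside_def
    proof (intro allI impI)
      fix y :: "real^'n" assume "r + 1 < norm y"
      moreover have "norm y \<le> norm (y + s *\<^sub>R axis i 1) + norm (s *\<^sub>R axis i (1::real))"
        using norm_triangle_ineq4[of "y + s *\<^sub>R axis i 1" "s *\<^sub>R axis i 1"] by simp
      ultimately have "r < norm (y + s *\<^sub>R axis i 1)"
        using that by simp
      then show "f (y + s *\<^sub>R axis i 1) = 0"
        using assms(4) by (simp add: zero_outside_def)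
    qed
  qed
  moreover have "integral\<^sup>L lborel (?F s) = integral\<^sup>L lborel f" for s
  proof -
    have "f \<in> borel_measurable borel" by (rule borel_measurable_continuous_onI[OF assms(2)])
    then have "integral\<^sup>L (distr lborel borel ((+) (s *\<^sub>R axis i 1))) f
        = integral\<^sup>L lborel (\<lambda>y. f (s *\<^sub>R axis i 1 + y))"
      by (subst integral_distr) auto
    then show ?thesis by (simp add: lborel_distr_plus add.commute)
  qed
  ultimately have "((\<lambda>s::real. integral\<^sup>L lborel f) has_real_derivative integral\<^sup>L lborel f') (at 0)"
    by simp
  then show ?thesis by (rule DERIV_unique) (rule DERIV_const)
qed

section \<open>Mollification\<close>

text \<open>The integration variable is rescaled so that the kernel \<open>k\<close> is fixed and \<open>\<epsilon>\<close> enters through \<open>f\<close> only. Then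
  all limits \<open>\<epsilon> \<rightarrow> 0\<close> are limits under an integral over a fixed ball.\<close>

definition mollify :: "(real^'n \<Rightarrow> real) \<Rightarrow> real \<Rightarrow> (real^'n \<Rightarrow> real) \<Rightarrow> real^'n \<Rightarrow> real" where
  "mollify k \<epsilon> f x = (LINT z|lborel. f (x - \<epsilon> *\<^sub>R z) * k z)"

lemma mollify_integrand:
  fixes f k :: "real^'n \<Rightarrow> real"
  assumes "continuous_on UNIV f" "continuous_on UNIV k" "zero_outside r k"
  shows "continuous_on UNIV (\<lambda>z. f (x - \<epsilon> *\<^sub>R z) * k z)"
    and "zero_outside r (\<lambda>z. f (x - \<epsilon> *\<^sub>R z) * k z)"
    and "integrable lborel (\<lambda>z. f (x - \<epsilon> *\<^sub>R z) * k z)"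
proof -
  show c: "continuous_on UNIV (\<lambda>z. f (x - \<epsilon> *\<^sub>R z) * k z)"
    by (intro continuous_intros assms(2) continuous_on_compose2[OF assms(1)]) auto
  show z: "zero_outside r (\<lambda>z. f (x - \<epsilon> *\<^sub>R z) * k z)"
    using assms(3) by (auto simp: zero_outside_def)
  show "integrable lborel (\<lambda>z. f (x - \<epsilon> *\<^sub>R z) * k z)"
    by (rule integral_zero_outside(1)[OF c z])
qed

text \<open>Integration by parts. It moves derivatives between \<open>f\<close> and the kernel at the price of a factor \<open>\<epsilon>\<close>, and is
  used in both directions.\<close>

lemma mollify_partial_kernel:
  fixes f k :: "real^'n \<Rightarrow> real"
  assumes f: "has_partial f i f'" "continuous_on UNIV f" "continuous_on UNIV f'"
    and k: "has_partial k i k'" "continuous_on UNIV k" "continuous_on UNIV k'" "zero_outside r k"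
  shows "mollify k' \<epsilon> f x = \<epsilon> * mollify k \<epsilon> f' x"
proof -
  let ?g = "\<lambda>z. f (x - \<epsilon> *\<^sub>R z)" and ?g' = "\<lambda>z. - \<epsilon> * f' (x - \<epsilon> *\<^sub>R z)"
  have g: "has_partial ?g i ?g'"
    unfolding has_partial_def
  proof
    fix z
    have "((\<lambda>s. f (x - \<epsilon> *\<^sub>R z + s *\<^sub>R axis i 1)) has_real_derivative f' (x - \<epsilon> *\<^sub>R z))
       (at (- \<epsilon> * 0))"
      using f(1) by (simp add: has_partial_def)
    from DERIV_chain2[where f = "\<lambda>s. f (x - \<epsilon> *\<^sub>R z + s *\<^sub>R axis i 1)" and g = "\<lambda>s. - \<epsilon> * s",
        OF this, of "- \<epsilon>" UNIV] DERIV_cmult_Id[of "- \<epsilon>" 0]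
    have "((\<lambda>s. f (x - \<epsilon> *\<^sub>R z + (- \<epsilon> * s) *\<^sub>R axis i 1)) has_real_derivative
        f' (x - \<epsilon> *\<^sub>R z) * - \<epsilon>) (at 0)"
      by blast
    then show "((\<lambda>s. f (x - \<epsilon> *\<^sub>R (z + s *\<^sub>R axis i 1))) has_real_derivative
        - \<epsilon> * f' (x - \<epsilon> *\<^sub>R z)) (at 0)"
      by (simp add: algebra_simps)
  qed
  have k': "zero_outside r k'" by (rule zero_outside_partial[OF k(1,4)])
  have cg: "continuous_on UNIV ?g" "continuous_on UNIV ?g'"
    by (intro continuous_intros continuous_on_compose2[OF f(2)] continuous_on_compose2[OF f(3)]; auto)+
  have "LINT z|lborel. ?g' z * k z + ?g z * k' z = 0"
    by (rule integral_partial_eq_0[OF has_partial_mult[OF g k(1)] _ _ mollify_integrand(2)[OF f(2) k(2,4)]])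
      (intro continuous_intros cg k)+
  moreover have "(\<lambda>z. ?g' z * k z) = (\<lambda>z. - \<epsilon> * (f' (x - \<epsilon> *\<^sub>R z) * k z))"
    by (simp add: algebra_simps)
  moreover note mollify_integrand(3)[OF f(3) k(2,4), of x \<epsilon>] mollify_integrand(3)[OF f(2) k(3) k', of x \<epsilon>]
  ultimately show ?thesis
    unfolding mollify_def by (simp add: mult.assoc)
qed

lemma mollify_has_partial:
  fixes f k :: "real^'n \<Rightarrow> real"
  assumes f: "has_partial f i f'" "continuous_on UNIV f" "continuous_on UNIV f'"
    and k: "continuous_on UNIV k" "zero_outside r k"
  shows "has_partial (mollify k \<epsilon> f) i (mollify k \<epsilon> f')"
  unfolding has_partial_def
proof
  fix x
  let ?F = "\<lambda>s z. f (x + s *\<^sub>R axis i 1 - \<epsilon> *\<^sub>R z) * k z"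
  let ?F' = "\<lambda>s z. f' (x + s *\<^sub>R axis i 1 - \<epsilon> *\<^sub>R z) * k z"
  have "((\<lambda>s. integral\<^sup>L lborel (?F s)) has_real_derivative integral\<^sup>L lborel (?F' 0)) (at 0)"
  proof (rule integral_param_derivative[where r = r])
    show "((\<lambda>s. ?F s z) has_real_derivative ?F' s z) (at s)" for s z
      using DERIV_cmult_right[OF has_partialD[OF f(1), of "x - \<epsilon> *\<^sub>R z" s], of "k z"]
      by (simp add: algebra_simps)
    show "continuous_on UNIV (?F s)" for s
      by (rule mollify_integrand[OF f(2) k])
    show "continuous_on UNIV (\<lambda>(s, z). ?F' s z)"
      unfolding case_prod_unfold
      by (intro continuous_intros continuous_on_compose2[OF f(3)] continuous_on_compose2[OF k(1)]) auto
    show "zero_outside r (?F s)" for s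
      by (rule mollify_integrand[OF f(2) k])
    show "zero_outside r (?F' 0)"
      by (rule mollify_integrand[OF f(3) k])
  qed
  then show "((\<lambda>s. mollify k \<epsilon> f (x + s *\<^sub>R axis i 1)) has_real_derivative mollify k \<epsilon> f' x) (at 0)"
    unfolding mollify_def by simp
qed

lemma continuous_on_mollify:
  fixes f k :: "real^'n \<Rightarrow> real"
  assumes "continuous_on UNIV f" "continuous_on UNIV k" "zero_outside r k"
  shows "continuous_on UNIV (mollify k \<epsilon> f)"
proof -
  have "continuous_on UNIV (\<lambda>x. integral (cbox (\<chi> i. - r) (\<chi> i. r)) (\<lambda>z. f (x - \<epsilon> *\<^sub>R z) * k z))"
    by (rule integral_continuous_on_param)
      (auto simp: case_prod_unfold intro!: continuous_intros continuous_on_compose2[OF assms(1)]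
        continuous_on_compose2[OF assms(2)])
  then show ?thesis
    unfolding mollify_def
    by (simp only: integral_zero_outside(2)[OF mollify_integrand(1,2)[OF assms]])
qed

lemma DERIV_positive_part_power:
  "((\<lambda>t. (max 0 t) ^ Suc (Suc n)) has_real_derivative real (Suc (Suc n)) * (max 0 t) ^ Suc n) (at t)"
proof -
  consider "t < 0" | "t > 0" | "t = 0" by linarith
  then show ?thesis
  proof cases
    case 1
    then have "\<forall>\<^sub>F u in nhds t. u \<in> {..<0}" by (intro eventually_nhds_in_open) auto
    then have "\<forall>\<^sub>F u in nhds t. (max 0 u) ^ Suc (Suc n) = (0::real)"
      by eventually_elim (auto simp: max_def)
    then show ?thesis
      using 1 by (subst DERIV_cong_ev[OF refl _ refl, where g = "\<lambda>_. 0"]) auto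
  next
    case 2
    then have "\<forall>\<^sub>F u in nhds t. u \<in> {0<..}" by (intro eventually_nhds_in_open) auto
    then have "\<forall>\<^sub>F u in nhds t. (max 0 u) ^ Suc (Suc n) = u ^ Suc (Suc n)"
      by eventually_elim (auto simp: max_def)
    moreover have "((\<lambda>u. u ^ Suc (Suc n)) has_real_derivative real (Suc (Suc n)) * (max 0 t) ^ Suc n) (at t)"
      using 2 DERIV_pow[of "Suc (Suc n)" t] by simp
    ultimately show ?thesis
      by (subst DERIV_cong_ev[OF refl _ refl, where g = "\<lambda>u. u ^ Suc (Suc n)"])
  next
    case 3
    have "((\<lambda>h. (max 0 h) ^ Suc (Suc n) / h) \<longlongrightarrow> 0) (at (0::real))"
    proof (rule Lim_null_comparison)
      have "norm ((max 0 h) ^ Suc (Suc n) / h) \<le> \<bar>h\<bar> ^ Suc n" for h :: real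
      proof (cases "h > 0")
        case False
        then have "max 0 h = 0" by simp
        then show ?thesis by (simp del: power_Suc)
      qed (auto simp: max_def)
      then show "\<forall>\<^sub>F h in at (0::real). norm ((max 0 h) ^ Suc (Suc n) / h) \<le> \<bar>h\<bar> ^ Suc n"
        by simp
      have "((\<lambda>h::real. \<bar>h\<bar> ^ Suc n) \<longlongrightarrow> \<bar>0\<bar> ^ Suc n) (at 0)"
        by (intro tendsto_intros)
      then show "((\<lambda>h::real. \<bar>h\<bar> ^ Suc n) \<longlongrightarrow> 0) (at 0)" by simp
    qed
    then show ?thesis using 3 by (simp add: DERIV_def)
  qed
qed

text \<open>Powers of the truncated parabola serve twice: the cube (\<open>n = 1\<close>, \<open>c = 1\<close>) is twice continuously differentiable and
  is the mollifier, the square (\<open>n = 0\<close>, \<open>c = R\<^sup>2\<close>) is the spatial cutoff.\<close>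

lemma has_partial_bump:
  fixes c :: real
  assumes "c \<noteq> 0"
  shows "has_partial (\<lambda>x::real^'n. (max 0 (1 - (norm x)\<^sup>2 / c)) ^ Suc (Suc n)) i
     (\<lambda>x. real (Suc (Suc n)) * (max 0 (1 - (norm x)\<^sup>2 / c)) ^ Suc n * (- 2 / c * x $ i))"
proof -
  have "has_partial (\<lambda>x::real^'n. 1 + (- 1 / c) * (norm x)\<^sup>2) i (\<lambda>x. 0 + (- 1 / c) * (2 * x $ i))"
    by (intro has_partial_add has_partial_cmult has_partial_norm_square) (simp add: has_partial_def)
  then have "has_partial (\<lambda>x::real^'n. 1 - (norm x)\<^sup>2 / c) i (\<lambda>x. - 2 / c * x $ i)"
    by (simp add: mult.commute)
  from has_partial_compose[OF this DERIV_positive_part_power] show ?thesis .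
qed

text \<open>Two derivatives of the kernel are needed: one for the curl of the momentum equation and one to trade for the
  derivative in \<open>\<omega>\<close> or in \<open>\<nabla>Q\<close>. Their symmetry \<open>\<rho>2 i j = \<rho>2 j i\<close> is what makes mollified gradients curl-free.\<close>

lemma smooth_kernel_exists:
  obtains \<rho> :: "real^'n \<Rightarrow> real" and \<rho>1 \<rho>2
  where "continuous_on UNIV \<rho>" "\<And>i. continuous_on UNIV (\<rho>1 i)" "\<And>i j. continuous_on UNIV (\<rho>2 i j)"
    and "\<And>i. has_partial \<rho> i (\<rho>1 i)" "\<And>i j. has_partial (\<rho>1 i) j (\<rho>2 i j)"
    and "\<And>i j. \<rho>2 i j = \<rho>2 j i" "zero_outside 1 \<rho>" "integral\<^sup>L lborel \<rho> = 1"
proof -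
  define b where "b = (\<lambda>x::real^'n. max 0 (1 - (norm x)\<^sup>2 / 1))"
  define m where "m = integral\<^sup>L lborel (\<lambda>x. b x ^ 3)"
  define \<rho> where "\<rho> = (\<lambda>x. 1 / m * b x ^ 3)"
  define \<rho>1 where "\<rho>1 = (\<lambda>i x. 1 / m * (3 * b x ^ 2 * (- 2 / 1 * x $ i)))"
  define \<rho>2 where "\<rho>2 = (\<lambda>i j x. 1 / m * (- 6) * (((2 * b x ^ 1 * (- 2 / 1 * x $ j)) * x $ i
    + b x ^ 2 * (if i = j then 1 else 0))))"
  have cb: "continuous_on UNIV b"
    unfolding b_def by (intro continuous_intros) auto
  have z3: "zero_outside 1 (\<lambda>x. b x ^ 3)"
    unfolding zero_outside_def b_def
  proof (intro allI impI)
    fix x :: "real^'n" assume "1 < norm x"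
    then have "1 \<le> (norm x)\<^sup>2" by (simp add: one_le_power)
    then show "max 0 (1 - (norm x)\<^sup>2 / 1) ^ 3 = 0" by simp
  qed
  have i3: "integrable lborel (\<lambda>x. b x ^ 3)"
    by (rule integral_zero_outside(1)[OF _ z3]) (intro continuous_intros cb)
  have "m > 0"
  proof -
    let ?A = "ball (0::real^'n) (1/2)"
    have iA: "integrable lborel (indicat_real ?A)"
      by (rule integrable_real_indicator) (simp, rule emeasure_lborel_ball_finite)
    have "(LINT x|lborel. indicator ?A x *\<^sub>R (1/8::real)) \<le> m"
      unfolding m_def
    proof (rule integral_mono[OF _ i3])
      show "integrable lborel (\<lambda>x. indicator ?A x *\<^sub>R (1/8::real))"
        using iA by (rule integrable_scaleR_left)
      fix x :: "real^'n"
      have "1/2 \<le> b x" if "norm x < 1/2"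
      proof -
        have "(norm x)\<^sup>2 \<le> (1/2)\<^sup>2" using that by (intro power_mono) auto
        then show ?thesis unfolding b_def by (simp add: power2_eq_square)
      qed
      from power_mono[OF this, of 3] show "indicator ?A x *\<^sub>R (1/8) \<le> b x ^ 3"
        by (auto simp: indicator_def power3_eq_cube b_def)
    qed
    moreover have "(LINT x|lborel. indicator ?A x *\<^sub>R (1/8::real)) = measure lborel ?A * (1/8)"
      using iA by (subst integral_scaleR_left) auto
    moreover have "measure lborel ?A > 0"
      by (rule content_ball_pos) simp
    ultimately show ?thesis by linarith
  qed
  show ?thesis
  proof (rule that[of \<rho> \<rho>1 \<rho>2])
    show "continuous_on UNIV \<rho>" "continuous_on UNIV (\<rho>1 i)" "continuous_on UNIV (\<rho>2 i j)" for i j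
      unfolding \<rho>_def \<rho>1_def \<rho>2_def by (intro continuous_intros cb)+
    show "has_partial \<rho> i (\<rho>1 i)" for i
      unfolding \<rho>_def \<rho>1_def b_def
      using has_partial_cmult[OF has_partial_bump[of 1 1 i], of "1/m"]
      by (simp add: eval_nat_numeral)
    show "has_partial (\<rho>1 i) j (\<rho>2 i j)" for i j
    proof -
      have "has_partial (\<lambda>x. b x ^ 2) j (\<lambda>x. 2 * b x ^ 1 * (- 2 / 1 * x $ j))"
        unfolding b_def using has_partial_bump[of 1 0 j] by (simp add: eval_nat_numeral)
      from has_partial_cmult[OF has_partial_mult[OF this has_partial_coordinate[of i j]], of "1 / m * (- 6)"]
      show ?thesis unfolding \<rho>1_def \<rho>2_def by (simp add: algebra_simps)
    qed
    show "\<rho>2 i j = \<rho>2 j i" for i j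
      unfolding \<rho>2_def by (auto simp: algebra_simps)
    show "zero_outside 1 \<rho>"
      using z3 unfolding \<rho>_def zero_outside_def by auto
    have "integral\<^sup>L lborel \<rho> = 1 / m * m"
      unfolding \<rho>_def by (simp add: m_def)
    then show "integral\<^sup>L lborel \<rho> = 1" using \<open>m > 0\<close> by simp
  qed
qed

text \<open>Integration by parts against a coordinate. These first moments evaluate the limit of the commutator.\<close>

lemma integral_partial_kernel_moment:
  fixes \<rho> :: "real^'n \<Rightarrow> real"
  assumes "has_partial \<rho> i \<rho>'" "continuous_on UNIV \<rho>" "continuous_on UNIV \<rho>'" "zero_outside r \<rho>"
  shows "(LINT z|lborel. z $ l * \<rho>' z) = - (if l = i then integral\<^sup>L lborel \<rho> else 0)"
proof -
  have "(LINT z|lborel. (if l = i then 1 else 0) * \<rho> z + z $ l * \<rho>' z) = 0"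
    by (rule integral_partial_eq_0[OF has_partial_mult[OF has_partial_coordinate assms(1)], where r = r])
      (use assms(4) in \<open>auto simp: zero_outside_def intro!: continuous_intros assms\<close>)
  moreover have "integrable lborel (\<lambda>z. (if l = i then 1 else 0) * \<rho> z)"
    using integral_zero_outside(1)[OF assms(2,4)] by simp
  moreover have "integrable lborel (\<lambda>z. z $ l * \<rho>' z)"
    using zero_outside_partial[OF assms(1,4)]
    by (intro integral_zero_outside(1)[of _ r] continuous_intros assms) (auto simp: zero_outside_def)
  ultimately show ?thesis by (simp split: if_splits)
qed

lemma mollify_add:
  fixes f g k :: "real^'n \<Rightarrow> real"
  assumes "continuous_on UNIV f" "continuous_on UNIV g" "continuous_on UNIV k" "zero_outside r k"
  shows "mollify k \<epsilon> (\<lambda>y. f y + g y) x = mollify k \<epsilon> f x + mollify k \<epsilon> g x"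
  unfolding mollify_def
  using mollify_integrand(3)[OF assms(1,3,4)] mollify_integrand(3)[OF assms(2,3,4)]
  by (simp add: distrib_right)

lemma mollify_diff:
  fixes f g k :: "real^'n \<Rightarrow> real"
  assumes "continuous_on UNIV f" "continuous_on UNIV g" "continuous_on UNIV k" "zero_outside r k"
  shows "mollify k \<epsilon> (\<lambda>y. f y - g y) x = mollify k \<epsilon> f x - mollify k \<epsilon> g x"
  unfolding mollify_def
  using mollify_integrand(3)[OF assms(1,3,4)] mollify_integrand(3)[OF assms(2,3,4)]
  by (simp add: left_diff_distrib)

lemma mollify_cmult: "mollify k \<epsilon> (\<lambda>y. c * f y) x = c * mollify k \<epsilon> f x"
  unfolding mollify_def by (simp add: mult.assoc)

lemma mollify_sum:
  fixes f :: "'i \<Rightarrow> real^'n \<Rightarrow> real"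
  assumes "\<And>i. continuous_on UNIV (f i)" "continuous_on UNIV k" "zero_outside r k"
  shows "mollify k \<epsilon> (\<lambda>y. \<Sum>i\<in>I. f i y) x = (\<Sum>i\<in>I. mollify k \<epsilon> (f i) x)"
  unfolding mollify_def sum_distrib_right
  by (rule Bochner_Integration.integral_sum) (rule mollify_integrand(3)[OF assms])

section \<open>Linear maps, powers and continuous functions\<close>

lemma linear_axis_expansion:
  fixes f :: "real^'n \<Rightarrow> 'a::real_vector"
  assumes "linear f"
  shows "f z = (\<Sum>m\<in>UNIV. (z $ m) *\<^sub>R f (axis m 1))"
proof -
  have "f z = f (\<Sum>m\<in>UNIV. (z $ m) *\<^sub>R axis m 1)"
    using basis_expansion[of z] by (simp add: scalar_mult_eq_scaleR)
  then show ?thesis using assms by (simp add: linear_sum linear_cmul)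
qed

text \<open>With \<open>t = s + \<delta>\<close>, compare \<open>s/t\<close> and \<open>\<delta>/t\<close>, which sum to \<open>1\<close>, with their \<open>q\<close>-th powers.\<close>

lemma powr_add_le:
  fixes s \<delta> q :: real
  assumes "0 \<le> s" "0 < \<delta>" "q \<le> 1"
  shows "(s + \<delta>) powr q \<le> s powr q + \<delta> powr q"
proof -
  define t where "t = s + \<delta>"
  have t: "t > 0" "s / t \<le> 1" "\<delta> / t \<le> 1" using assms by (auto simp: t_def)
  have "t powr q * (s / t) \<le> t powr q * (s / t) powr q"
    using powr_mono'[of q 1 "s / t"] assms t by (intro mult_left_mono) auto
  moreover have "t powr q * (\<delta> / t) \<le> t powr q * (\<delta> / t) powr q"
    using powr_mono'[of q 1 "\<delta> / t"] assms t by (intro mult_left_mono) auto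
  moreover have "t powr q * (s / t) + t powr q * (\<delta> / t) = t powr q"
    using t by (simp add: t_def distrib_left[symmetric] add_divide_distrib[symmetric])
  moreover have "t powr q * (s / t) powr q = s powr q" "t powr q * (\<delta> / t) powr q = \<delta> powr q"
    using t assms by (auto simp: powr_divide)
  ultimately show ?thesis by (simp add: t_def)
qed

lemma continuous_AE_zero_imp_zero:
  fixes f :: "real^'n \<Rightarrow> real"
  assumes "continuous_on UNIV f" "AE x in lborel. f x = 0"
  shows "f x = 0"
proof -
  let ?U = "{x. f x \<noteq> 0}"
  have "open ?U"
    by (intro open_Collect_neq assms continuous_intros)
  moreover have "negligible ?U"
  proof -
    have "?U \<in> null_sets lborel"
      using assms \<open>open ?U\<close> AE_iff_null[of lborel "\<lambda>x. f x = 0"] by simp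
    then show ?thesis
      by (simp add: negligible_iff_null_sets null_sets_completionI)
  qed
  ultimately have "?U = {}" using open_not_negligible by blast
  then show ?thesis by blast
qed

section \<open>Stationary transport of vorticity\<close>

text \<open>The stationary momentum equation in rotational form. For \<open>W = V + b y\<close> the term \<open>\<Sum>\<^sub>j W\<^sub>j \<partial>\<^sub>i V\<^sub>j\<close> is the gradient of
  \<open>|V|\<^sup>2/2 + b y \<cdot> V\<close> up to \<open>b V\<^sub>i\<close>, and \<open>Q\<close> absorbs that gradient together with the pressure.\<close>

locale vorticity_transport =
  fixes V W :: "real^'n \<Rightarrow> real^'n" and V' W' :: "real^'n \<Rightarrow> real^'n \<Rightarrow> real^'n"
    and Q :: "real^'n \<Rightarrow> real" and c d L :: real
  assumes V: "(V has_derivative V' x) (at x)"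
    and W: "(W has_derivative W' x) (at x)"
    and cont_V': "continuous_on UNIV (\<lambda>x. V' x (axis i 1) $ j)"
    and cont_W': "continuous_on UNIV (\<lambda>x. W' x (axis i 1) $ j)"
    and bound_V': "norm (V' x h) \<le> L * norm h"
    and bound_W': "norm (W' x h) \<le> L * norm h"
    and div_W: "(\<Sum>i\<in>UNIV. W' x (axis i 1) $ i) = d"
    and continuous_Q: "continuous_on UNIV Q"
    and momentum: "has_partial Q i (\<lambda>x. - (c * V x $ i +
        (\<Sum>j\<in>UNIV. W x $ j * (V' x (axis j 1) $ i - V' x (axis i 1) $ j))))"
begin

definition vort :: "'n \<Rightarrow> 'n \<Rightarrow> real^'n \<Rightarrow> real" where
  "vort i j x = V' x (axis i 1) $ j - V' x (axis j 1) $ i"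

definition dW :: "'n \<Rightarrow> 'n \<Rightarrow> real^'n \<Rightarrow> real" where
  "dW i j x = W' x (axis i 1) $ j"

text \<open>The right-hand side of the vorticity equation: formally \<open>W \<cdot> \<nabla>(vort k i)\<close> equals this. Taking \<open>\<partial>\<^sub>k\<close> of the \<open>i\<close>-th
  momentum equation minus \<open>\<partial>\<^sub>i\<close> of the \<open>k\<close>-th, the terms with \<open>\<nabla>vort\<close> combine by the Bianchi identity
  \<open>\<partial>\<^sub>k vort j i + \<partial>\<^sub>i vort k j = \<partial>\<^sub>j vort k i\<close>.\<close>

definition transport_rate :: "'n \<Rightarrow> 'n \<Rightarrow> real^'n \<Rightarrow> real" where
  "transport_rate k i x = - (c * vort k i x) -
     (\<Sum>j\<in>UNIV. dW k j x * vort j i x + dW i j x * vort k j x)"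

lemma vort_antisym: "vort j i x = - vort i j x"
  by (simp add: vort_def)

lemma L_nonneg: "0 \<le> L"
proof -
  have "0 \<le> norm (W' 0 (axis undefined 1))" by simp
  also have "\<dots> \<le> L" using bound_W'[of 0 "axis undefined 1"] by simp
  finally show ?thesis .
qed

lemma continuous_V: "continuous_on UNIV (\<lambda>x. V x $ i)"
  and continuous_W: "continuous_on UNIV (\<lambda>x. W x $ i)"
  using has_derivative_continuous[OF V] has_derivative_continuous[OF W]
  by (auto intro!: continuous_intros simp: continuous_on_eq_continuous_at)

lemma continuous_vort: "continuous_on UNIV (vort i j)"
  unfolding vort_def by (intro continuous_intros cont_V')

lemma continuous_dW: "continuous_on UNIV (dW i j)"
  unfolding dW_def by (rule cont_W')

lemma continuous_transport_rate: "continuous_on UNIV (transport_rate k i)"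
  unfolding transport_rate_def by (intro continuous_intros continuous_vort continuous_dW)

lemma dW_bound: "\<bar>dW i j x\<bar> \<le> L"
  unfolding dW_def
  using component_le_norm_cart[of "W' x (axis i 1)" j] bound_W'[of x "axis i 1"] by simp

lemma vort_bound: "\<bar>vort i j x\<bar> \<le> 2 * L"
  unfolding vort_def
  using component_le_norm_cart[of "V' x (axis i 1)" j] bound_V'[of x "axis i 1"]
    component_le_norm_cart[of "V' x (axis j 1)" i] bound_V'[of x "axis j 1"] by simp

lemma W_lipschitz: "norm (W y - W x) \<le> L * norm (y - x)"
proof (rule differentiable_bound[of UNIV W W'])
  show "onorm (W' x) \<le> L" for x
    using bound_W' by (rule onorm_bound[OF L_nonneg])
qed (use W in auto)

lemma has_partial_V: "has_partial (\<lambda>x. V x $ i) j (\<lambda>x. V' x (axis j 1) $ i)"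
  by (rule has_partial_component[OF V])

lemma has_partial_W: "has_partial (\<lambda>x. W x $ i) j (dW j i)"
  unfolding dW_def by (rule has_partial_component[OF W])

section \<open>The mollified vorticity equation\<close>

context
  fixes \<rho> :: "real^'n \<Rightarrow> real" and \<rho>1 :: "'n \<Rightarrow> real^'n \<Rightarrow> real" and \<rho>2 :: "'n \<Rightarrow> 'n \<Rightarrow> real^'n \<Rightarrow> real"
  assumes kc: "continuous_on UNIV \<rho>" "\<And>i. continuous_on UNIV (\<rho>1 i)"
      "\<And>i j. continuous_on UNIV (\<rho>2 i j)"
    and kd: "\<And>i. has_partial \<rho> i (\<rho>1 i)" "\<And>i j. has_partial (\<rho>1 i) j (\<rho>2 i j)"
    and sym: "\<And>i j. \<rho>2 i j = \<rho>2 j i" and k0: "zero_outside 1 \<rho>"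
begin

private lemma k1: "zero_outside 1 (\<rho>1 i)"
  by (rule zero_outside_partial[OF kd(1) k0])

private lemma k2: "zero_outside 1 (\<rho>2 i j)"
  by (rule zero_outside_partial[OF kd(2) k1])

text \<open>The curl in \<open>vort\<close> moves to the kernel. In this form the mollified vorticity is a combination of mollified
  components of \<open>V\<close>, which are differentiable because \<open>V\<close> is.\<close>

lemma mollify_vort_eq:
  "\<epsilon> * mollify \<rho> \<epsilon> (vort k i) x
   = mollify (\<rho>1 k) \<epsilon> (\<lambda>y. V y $ i) x - mollify (\<rho>1 i) \<epsilon> (\<lambda>y. V y $ k) x"
  unfolding vort_def
  by (simp add: mollify_diff[OF cont_V' cont_V' kc(1) k0] right_diff_distrib
      mollify_partial_kernel[OF has_partial_V continuous_V cont_V' kd(1) kc(1,2) k0])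

lemma mollify_partial_vort_eq:
  "\<epsilon> * mollify (\<rho>1 l) \<epsilon> (vort k i) x
   = mollify (\<rho>2 l k) \<epsilon> (\<lambda>y. V y $ i) x - mollify (\<rho>2 l i) \<epsilon> (\<lambda>y. V y $ k) x"
  unfolding vort_def
  by (simp add: mollify_diff[OF cont_V' cont_V' kc(2) k1] right_diff_distrib
      mollify_partial_kernel[OF has_partial_V continuous_V cont_V' kd(2) kc(2,3) k1])

text \<open>With both derivatives on the kernel the six second derivatives cancel in pairs by symmetry.\<close>

lemma mollify_bianchi:
  assumes "\<epsilon> \<noteq> 0"
  shows "mollify (\<rho>1 k) \<epsilon> (vort j i) x + mollify (\<rho>1 i) \<epsilon> (vort k j) x = mollify (\<rho>1 j) \<epsilon> (vort k i) x"
proof -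
  have "\<epsilon> * (mollify (\<rho>1 k) \<epsilon> (vort j i) x + mollify (\<rho>1 i) \<epsilon> (vort k j) x)
      = \<epsilon> * mollify (\<rho>1 j) \<epsilon> (vort k i) x"
    unfolding distrib_left mollify_partial_vort_eq
    by (simp add: sym[of k j] sym[of i k] sym[of i j])
  then show ?thesis using assms by simp
qed

text \<open>A derivative falls on \<open>V\<close> in the representation \<open>mollify_vort_eq\<close>; trading it for a second derivative of the
  kernel and using its symmetry exhibits the derivative as the mollification of \<open>vort\<close> with \<open>\<rho>1 l\<close>.\<close>

lemma has_partial_mollify_vort:
  assumes "\<epsilon> \<noteq> 0"
  shows "has_partial (mollify \<rho> \<epsilon> (vort k i)) l (\<lambda>x. mollify (\<rho>1 l) \<epsilon> (vort k i) x / \<epsilon>)"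
proof -
  have eq: "mollify \<rho> \<epsilon> (vort k i) = (\<lambda>x. 1 / \<epsilon> * (mollify (\<rho>1 k) \<epsilon> (\<lambda>y. V y $ i) x
      + - 1 * mollify (\<rho>1 i) \<epsilon> (\<lambda>y. V y $ k) x))"
    using mollify_vort_eq[of \<epsilon> k i] assms by (auto simp: field_simps)
  have eq': "(\<lambda>x. mollify (\<rho>1 l) \<epsilon> (vort k i) x / \<epsilon>)
    = (\<lambda>x. 1 / \<epsilon> * (mollify (\<rho>1 k) \<epsilon> (\<lambda>y. V' y (axis l 1) $ i) x
      + - 1 * mollify (\<rho>1 i) \<epsilon> (\<lambda>y. V' y (axis l 1) $ k) x))"
  proof
    fix x
    have "\<epsilon> * mollify (\<rho>1 l) \<epsilon> (vort k i) x = \<epsilon> * (mollify (\<rho>1 k) \<epsilon> (\<lambda>y. V' y (axis l 1) $ i) x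
      - mollify (\<rho>1 i) \<epsilon> (\<lambda>y. V' y (axis l 1) $ k) x)"
      unfolding mollify_partial_vort_eq right_diff_distrib
      by (simp add: sym[of l k] sym[of l i]
          mollify_partial_kernel[OF has_partial_V continuous_V cont_V' kd(2) kc(2,3) k1])
    then show "mollify (\<rho>1 l) \<epsilon> (vort k i) x / \<epsilon> = 1 / \<epsilon> * (mollify (\<rho>1 k) \<epsilon> (\<lambda>y. V' y (axis l 1) $ i) x
      + - 1 * mollify (\<rho>1 i) \<epsilon> (\<lambda>y. V' y (axis l 1) $ k) x)"
      using assms by simp
  qed
  show ?thesis
    unfolding eq eq'
    by (intro has_partial_cmult has_partial_add
        mollify_has_partial[OF has_partial_V continuous_V cont_V' kc(2) k1])
qed

text \<open>The error made by replacing \<open>W\<close> at \<open>x - \<epsilon> z\<close> by \<open>W\<close> at \<open>x\<close>. The derivative of the kernel costs \<open>1/\<epsilon>\<close>, which the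
  difference quotient of the Lipschitz field \<open>W\<close> compensates.\<close>

definition commutator :: "'n \<Rightarrow> 'n \<Rightarrow> 'n \<Rightarrow> 'n \<Rightarrow> real \<Rightarrow> real^'n \<Rightarrow> real" where
  "commutator l j p q \<epsilon> x =
     (LINT z|lborel. ((W (x - \<epsilon> *\<^sub>R z) - W x) $ j / \<epsilon>) * vort p q (x - \<epsilon> *\<^sub>R z) * \<rho>1 l z)"

text \<open>Mollify the momentum equation and take its curl on the kernel: the gradient of \<open>Q\<close> drops out. Splitting
  \<open>W\<close> at \<open>x - \<epsilon> z\<close> into its value at \<open>x\<close> and an increment, the former produces \<open>W \<cdot> \<nabla>\<close> of the mollified
  vorticity by the Bianchi identity, the latter the commutators.\<close>

lemma mollified_transport:
  assumes "\<epsilon> \<noteq> 0"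
  shows "(\<Sum>j\<in>UNIV. W x $ j * (mollify (\<rho>1 j) \<epsilon> (vort k i) x / \<epsilon>))
    = - (c * mollify \<rho> \<epsilon> (vort k i) x)
      - (\<Sum>j\<in>UNIV. commutator k j j i \<epsilon> x + commutator i j k j \<epsilon> x)"
proof -
  define F where "F = (\<lambda>i y. c * V y $ i + (\<Sum>j\<in>UNIV. W y $ j * vort j i y))"
  have cWv: "continuous_on UNIV (\<lambda>y. W y $ j * vort p q y)" for j p q
    by (intro continuous_intros continuous_W continuous_vort)
  have cF: "continuous_on UNIV (F i)" for i
    unfolding F_def by (intro continuous_intros continuous_V cWv)
  have Q: "has_partial Q i (\<lambda>x. - F i x)" for i
    using momentum[of i] unfolding F_def vort_def .
  have split: "mollify (\<rho>1 l) \<epsilon> (\<lambda>y. W y $ j * vort p q y) x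
      = \<epsilon> * commutator l j p q \<epsilon> x + W x $ j * mollify (\<rho>1 l) \<epsilon> (vort p q) x" for l j p q
  proof -
    have "\<epsilon> * commutator l j p q \<epsilon> x = mollify (\<rho>1 l) \<epsilon> (\<lambda>y. W y $ j * vort p q y - W x $ j * vort p q y) x"
      unfolding commutator_def mollify_def integral_mult_right_zero[symmetric]
      using assms by (intro Bochner_Integration.integral_cong) (auto simp: field_simps)
    also have "\<dots> = mollify (\<rho>1 l) \<epsilon> (\<lambda>y. W y $ j * vort p q y) x
        - mollify (\<rho>1 l) \<epsilon> (\<lambda>y. W x $ j * vort p q y) x"
      by (rule mollify_diff[OF cWv _ kc(2) k1]) (intro continuous_intros continuous_vort)
    finally show ?thesis by (simp add: mollify_cmult)
  qed
  have expand: "mollify (\<rho>1 l) \<epsilon> (F m) x = c * mollify (\<rho>1 l) \<epsilon> (\<lambda>y. V y $ m) x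
      + (\<Sum>j\<in>UNIV. \<epsilon> * commutator l j j m \<epsilon> x + W x $ j * mollify (\<rho>1 l) \<epsilon> (vort j m) x)" for l m
  proof -
    have "mollify (\<rho>1 l) \<epsilon> (F m) x = mollify (\<rho>1 l) \<epsilon> (\<lambda>y. c * V y $ m) x
      + mollify (\<rho>1 l) \<epsilon> (\<lambda>y. \<Sum>j\<in>UNIV. W y $ j * vort j m y) x"
      unfolding F_def
      by (rule mollify_add[OF _ _ kc(2) k1]) (intro continuous_intros continuous_V cWv)+
    then show ?thesis
      by (simp add: mollify_cmult mollify_sum[OF cWv kc(2) k1] split)
  qed
  have "mollify (\<rho>1 k) \<epsilon> (\<lambda>y. - 1 * F i y) x = mollify (\<rho>1 i) \<epsilon> (\<lambda>y. - 1 * F k y) x"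
  proof -
    have "\<epsilon> * mollify (\<rho>1 l) \<epsilon> (\<lambda>y. - F m y) x = mollify (\<rho>2 l m) \<epsilon> Q x" for l m
      by (rule mollify_partial_kernel[OF Q continuous_Q _ kd(2) kc(2,3) k1, symmetric]) (intro continuous_intros cF)
    from this[of k i] this[of i k]
    have "\<epsilon> * mollify (\<rho>1 k) \<epsilon> (\<lambda>y. - F i y) x = \<epsilon> * mollify (\<rho>1 i) \<epsilon> (\<lambda>y. - F k y) x"
      by (simp add: sym[of k i])
    then show ?thesis using assms by simp
  qed
  then have "mollify (\<rho>1 k) \<epsilon> (F i) x = mollify (\<rho>1 i) \<epsilon> (F k) x"
    unfolding mollify_cmult by simp
  then have *: "c * (\<epsilon> * mollify \<rho> \<epsilon> (vort k i) x)
    + (\<Sum>j\<in>UNIV. (\<epsilon> * commutator k j j i \<epsilon> x + W x $ j * mollify (\<rho>1 k) \<epsilon> (vort j i) x)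
         - (\<epsilon> * commutator i j j k \<epsilon> x + W x $ j * mollify (\<rho>1 i) \<epsilon> (vort j k) x)) = 0"
    unfolding expand mollify_vort_eq by (simp add: algebra_simps sum_subtractf)
  \<comment> \<open>The antisymmetry of \<open>vort\<close> brings the second momentum component into the index order of the Bianchi identity.\<close>
  have anti: "commutator i j j k \<epsilon> x = - commutator i j k j \<epsilon> x"
      "mollify (\<rho>1 i) \<epsilon> (vort j k) x = - mollify (\<rho>1 i) \<epsilon> (vort k j) x" for j
    unfolding commutator_def mollify_def vort_antisym[of j k] by simp_all
  have "(\<epsilon> * commutator k j j i \<epsilon> x + W x $ j * mollify (\<rho>1 k) \<epsilon> (vort j i) x)
         - (\<epsilon> * commutator i j j k \<epsilon> x + W x $ j * mollify (\<rho>1 i) \<epsilon> (vort j k) x)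
     = \<epsilon> * (commutator k j j i \<epsilon> x + commutator i j k j \<epsilon> x
        + W x $ j * (mollify (\<rho>1 j) \<epsilon> (vort k i) x / \<epsilon>))" for j
    unfolding anti mollify_bianchi[OF assms, of k j i x, symmetric]
    using assms by (simp add: field_simps)
  with * have "\<epsilon> * (c * mollify \<rho> \<epsilon> (vort k i) x
    + (\<Sum>j\<in>UNIV. commutator k j j i \<epsilon> x + commutator i j k j \<epsilon> x
        + W x $ j * (mollify (\<rho>1 j) \<epsilon> (vort k i) x / \<epsilon>))) = 0"
    by (simp add: sum_distrib_left distrib_left mult.left_commute)
  then have "c * mollify \<rho> \<epsilon> (vort k i) x
    + (\<Sum>j\<in>UNIV. commutator k j j i \<epsilon> x + commutator i j k j \<epsilon> x
        + W x $ j * (mollify (\<rho>1 j) \<epsilon> (vort k i) x / \<epsilon>)) = 0"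
    using assms by simp
  then show ?thesis by (simp add: sum.distrib)
qed


lemma linear_W': "W' x z $ j = (\<Sum>m\<in>UNIV. z $ m * dW m j x)"
  by (simp add: linear_axis_expansion[OF has_derivative_linear[OF W], of x z] dW_def)

private lemma commutator_integrand_bound:
  assumes "\<epsilon> > 0"
  shows "\<bar>((W (x - \<epsilon> *\<^sub>R z) - W x) $ j / \<epsilon>) * vort p q (x - \<epsilon> *\<^sub>R z) * \<rho>1 l z\<bar>
     \<le> L * norm z * (2 * L) * \<bar>\<rho>1 l z\<bar>"
proof -
  have "\<bar>(W (x - \<epsilon> *\<^sub>R z) - W x) $ j\<bar> \<le> L * norm (x - \<epsilon> *\<^sub>R z - x)"
    using W_lipschitz component_le_norm_cart order_trans by blast
  then have "\<bar>(W (x - \<epsilon> *\<^sub>R z) - W x) $ j / \<epsilon>\<bar> \<le> L * norm z"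
    using assms by (simp add: field_simps)
  then show ?thesis
    unfolding abs_mult using L_nonneg vort_bound[of p q "x - \<epsilon> *\<^sub>R z"]
    by (intro mult_mono) auto
qed

private lemma commutator_majorant: "integrable lborel (\<lambda>z. L * norm z * (2 * L) * \<bar>\<rho>1 l z\<bar>)"
  by (rule integral_zero_outside(1)[of _ 1])
    (use k1[of l] in \<open>auto simp: zero_outside_def intro!: continuous_intros kc(2)\<close>)

private lemma commutator_integrand_continuous:
  "continuous_on UNIV (\<lambda>z. ((W (x - \<epsilon> *\<^sub>R z) - W x) $ j / \<epsilon>) * vort p q (x - \<epsilon> *\<^sub>R z) * \<rho>1 l z)"
proof -
  have "continuous_on UNIV (\<lambda>z. (W (x - \<epsilon> *\<^sub>R z) $ j - W x $ j) * inverse \<epsilon> * vort p q (x - \<epsilon> *\<^sub>R z) * \<rho>1 l z)"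
    by (intro continuous_intros kc(2) continuous_on_compose2[OF continuous_W]
      continuous_on_compose2[OF continuous_vort]) auto
  then show ?thesis by (simp add: divide_inverse)
qed

private lemma commutator_integrand_integrable:
  "integrable lborel (\<lambda>z. ((W (x - \<epsilon> *\<^sub>R z) - W x) $ j / \<epsilon>) * vort p q (x - \<epsilon> *\<^sub>R z) * \<rho>1 l z)"
  by (rule integral_zero_outside(1)[OF commutator_integrand_continuous, of 1])
    (use k1[of l] in \<open>auto simp: zero_outside_def\<close>)

lemma commutator_bound:
  assumes "\<epsilon> > 0"
  shows "\<bar>commutator l j p q \<epsilon> x\<bar> \<le> (LINT z|lborel. L * norm z * (2 * L) * \<bar>\<rho>1 l z\<bar>)"
  unfolding commutator_def
  by (rule integral_abs_bound_integral[OF commutator_integrand_integrable commutator_majorant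
        commutator_integrand_bound[OF assms]])

text \<open>The difference quotient of \<open>W\<close> tends to \<open>- W' x z\<close>, which is linear in \<open>z\<close>, while \<open>vort\<close> tends to its value at \<open>x\<close>.
  The limit is therefore a combination of first moments of \<open>\<rho>1 l\<close>, of which only the \<open>l\<close>-th survives, with value \<open>-1\<close>.\<close>

lemma commutator_limit:
  assumes "integral\<^sup>L lborel \<rho> = 1"
  shows "(\<lambda>n. commutator l j p q (inverse (real (Suc n))) x) \<longlonglongrightarrow> dW l j x * vort p q x"
proof -
  let ?e = "\<lambda>n. inverse (real (Suc n))"
  have e: "filterlim ?e (at 0) sequentially"
    by (rule filterlim_atI[OF LIMSEQ_inverse_real_of_nat]) simp
  have "(\<lambda>n. commutator l j p q (?e n) x) \<longlonglongrightarrow> (LINT z|lborel. - W' x z $ j * vort p q x * \<rho>1 l z)"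
    unfolding commutator_def
  proof (rule integral_dominated_convergence[OF _ _ commutator_majorant])
    show "(\<lambda>z. - W' x z $ j * vort p q x * \<rho>1 l z) \<in> borel_measurable lborel"
      unfolding linear_W' vector_uminus_component
      by (auto intro!: borel_measurable_continuous_onI continuous_intros kc(2))
    show "(\<lambda>z. ((W (x - ?e n *\<^sub>R z) - W x) $ j / ?e n) * vort p q (x - ?e n *\<^sub>R z) * \<rho>1 l z)
        \<in> borel_measurable lborel" for n
      by (rule borel_measurable_integrable[OF commutator_integrand_integrable])
    show "AE z in lborel. norm (((W (x - ?e n *\<^sub>R z) - W x) $ j / ?e n) * vort p q (x - ?e n *\<^sub>R z) * \<rho>1 l z)
        \<le> L * norm z * (2 * L) * \<bar>\<rho>1 l z\<bar>" for n
      using commutator_integrand_bound[of "?e n"] by simp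
    have "(\<lambda>n. ((W (x - ?e n *\<^sub>R z) - W x) $ j / ?e n) * vort p q (x - ?e n *\<^sub>R z) * \<rho>1 l z)
        \<longlonglongrightarrow> - W' x z $ j * vort p q x * \<rho>1 l z" for z
    proof (intro tendsto_mult tendsto_const)
      have "((\<lambda>s. x - s *\<^sub>R z) has_derivative (\<lambda>s. - (s *\<^sub>R z))) (at (0::real))"
        by (auto intro!: derivative_eq_intros)
      moreover have "(W has_derivative W' x) (at (x - 0 *\<^sub>R z))" using W by simp
      ultimately have "((\<lambda>s. W (x - s *\<^sub>R z)) has_derivative (\<lambda>s. W' x (- (s *\<^sub>R z)))) (at 0)"
        by (rule has_derivative_compose)
      then have "((\<lambda>s. W (x - s *\<^sub>R z) $ j) has_derivative (\<lambda>s. W' x (- (s *\<^sub>R z)) $ j)) (at 0)"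
        by (rule bounded_linear.has_derivative[OF bounded_linear_vec_nth])
      moreover have "W' x (- (s *\<^sub>R z)) $ j = (- W' x z $ j) * s" for s
        using has_derivative_linear[OF W[of x]] by (simp add: linear_cmul linear_neg)
      ultimately have "((\<lambda>s. W (x - s *\<^sub>R z) $ j) has_real_derivative - W' x z $ j) (at 0)"
        by (simp only: has_field_derivative_def)
      then have "((\<lambda>h. (W (x - h *\<^sub>R z) - W x) $ j / h) \<longlongrightarrow> - W' x z $ j) (at 0)"
        by (simp add: DERIV_def)
      from filterlim_compose[OF this e]
      show "(\<lambda>n. (W (x - ?e n *\<^sub>R z) - W x) $ j / ?e n) \<longlonglongrightarrow> - W' x z $ j" .
      have "isCont (vort p q) x"
        using continuous_vort by (simp add: continuous_on_eq_continuous_at)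
      moreover have "(\<lambda>n. x - ?e n *\<^sub>R z) \<longlonglongrightarrow> x"
      proof -
        have "(\<lambda>n. x - ?e n *\<^sub>R z) \<longlonglongrightarrow> x - 0 *\<^sub>R z"
          by (intro tendsto_intros LIMSEQ_inverse_real_of_nat)
        then show ?thesis by simp
      qed
      ultimately show "(\<lambda>n. vort p q (x - ?e n *\<^sub>R z)) \<longlonglongrightarrow> vort p q x"
        by (rule isCont_tendsto_compose)
    qed
    then show "AE z in lborel. (\<lambda>n. ((W (x - ?e n *\<^sub>R z) - W x) $ j / ?e n) * vort p q (x - ?e n *\<^sub>R z) * \<rho>1 l z)
        \<longlonglongrightarrow> - W' x z $ j * vort p q x * \<rho>1 l z" by simp
  qed
  moreover have "(LINT z|lborel. - W' x z $ j * vort p q x * \<rho>1 l z) = dW l j x * vort p q x"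
  proof -
    have "(\<lambda>z. - W' x z $ j * vort p q x * \<rho>1 l z)
        = (\<lambda>z. \<Sum>m\<in>UNIV. (- dW m j x * vort p q x) * (z $ m * \<rho>1 l z))"
      unfolding vector_uminus_component linear_W'
      by (simp add: sum_distrib_right sum_distrib_left sum_negf algebra_simps)
    moreover have "integrable lborel (\<lambda>z. (- dW m j x * vort p q x) * (z $ m * \<rho>1 l z))" for m
      by (rule integral_zero_outside(1)[of _ 1])
        (use k1[of l] in \<open>auto simp: zero_outside_def intro!: continuous_intros kc(2)\<close>)
    ultimately have "(LINT z|lborel. - W' x z $ j * vort p q x * \<rho>1 l z)
        = (\<Sum>m\<in>UNIV. (- dW m j x * vort p q x) * (LINT z|lborel. z $ m * \<rho>1 l z))"
      by simp
    also have "\<dots> = (\<Sum>m\<in>UNIV. if m = l then dW m j x * vort p q x else 0)"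
      by (intro sum.cong refl)
        (simp add: integral_partial_kernel_moment[OF kd(1) kc(1,2) k0] assms)
    finally show ?thesis by simp
  qed
  ultimately show ?thesis by simp
qed

lemma mollify_vort_bound:
  "\<bar>mollify \<rho> \<epsilon> (vort k i) x\<bar> \<le> (LINT z|lborel. 2 * L * \<bar>\<rho> z\<bar>)"
  unfolding mollify_def
proof (rule integral_abs_bound_integral[OF mollify_integrand(3)[OF continuous_vort kc(1) k0]])
  show "integrable lborel (\<lambda>z. 2 * L * \<bar>\<rho> z\<bar>)"
    by (rule integral_zero_outside(1)[of _ 1])
      (use k0 in \<open>auto simp: zero_outside_def intro!: continuous_intros kc(1)\<close>)
  show "\<bar>vort k i (x - \<epsilon> *\<^sub>R z) * \<rho> z\<bar> \<le> 2 * L * \<bar>\<rho> z\<bar>" for z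
    unfolding abs_mult by (intro mult_right_mono vort_bound) simp
qed

lemma mollify_vort_limit:
  assumes "integral\<^sup>L lborel \<rho> = 1"
  shows "(\<lambda>n. mollify \<rho> (inverse (real (Suc n))) (vort k i) x) \<longlonglongrightarrow> vort k i x"
proof -
  let ?e = "\<lambda>n. inverse (real (Suc n))"
  have "(\<lambda>n. mollify \<rho> (?e n) (vort k i) x) \<longlonglongrightarrow> (LINT z|lborel. vort k i x * \<rho> z)"
    unfolding mollify_def
  proof (rule integral_dominated_convergence)
    show "integrable lborel (\<lambda>z. 2 * L * \<bar>\<rho> z\<bar>)"
      by (rule integral_zero_outside(1)[of _ 1])
        (use k0 in \<open>auto simp: zero_outside_def intro!: continuous_intros kc(1)\<close>)
    show "(\<lambda>z. vort k i x * \<rho> z) \<in> borel_measurable lborel"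
      by (auto intro!: borel_measurable_continuous_onI continuous_intros kc(1))
    show "(\<lambda>z. vort k i (x - ?e n *\<^sub>R z) * \<rho> z) \<in> borel_measurable lborel" for n
      using mollify_integrand(3)[OF continuous_vort kc(1) k0] by (rule borel_measurable_integrable)
    show "AE z in lborel. norm (vort k i (x - ?e n *\<^sub>R z) * \<rho> z) \<le> 2 * L * \<bar>\<rho> z\<bar>" for n
      unfolding real_norm_def abs_mult by (intro AE_I2 mult_right_mono vort_bound) simp
    have "isCont (vort k i) x"
      using continuous_vort by (simp add: continuous_on_eq_continuous_at)
    moreover have "(\<lambda>n. x - ?e n *\<^sub>R z) \<longlonglongrightarrow> x" for z
    proof -
      have "(\<lambda>n. x - ?e n *\<^sub>R z) \<longlonglongrightarrow> x - 0 *\<^sub>R z"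
        by (intro tendsto_intros LIMSEQ_inverse_real_of_nat)
      then show ?thesis by simp
    qed
    ultimately have "(\<lambda>n. vort k i (x - ?e n *\<^sub>R z)) \<longlonglongrightarrow> vort k i x" for z
      by (rule isCont_tendsto_compose)
    then show "AE z in lborel. (\<lambda>n. vort k i (x - ?e n *\<^sub>R z) * \<rho> z) \<longlonglongrightarrow> vort k i x * \<rho> z"
      by (intro AE_I2 tendsto_intros)
  qed
  then show ?thesis using assms by simp
qed

end

text \<open>The substitute for a pointwise vorticity equation: smooth fields converge boundedly to \<open>vort\<close> while their
  derivatives along \<open>W\<close> converge boundedly to the formal right-hand side. Only the derivatives along \<open>W\<close> are
  controlled; the full gradients may blow up as \<open>n\<close> grows.\<close>

lemma vorticity_approximation:
  obtains u :: "nat \<Rightarrow> 'n \<Rightarrow> 'n \<Rightarrow> real^'n \<Rightarrow> real" and u' B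
  where "\<And>n k i l. has_partial (u n k i) l (u' n l k i)"
    and "\<And>n k i. continuous_on UNIV (u n k i)" "\<And>n k i l. continuous_on UNIV (u' n l k i)"
    and "\<And>n k i x. \<bar>u n k i x\<bar> \<le> B"
    and "\<And>n k i x. \<bar>\<Sum>l\<in>UNIV. W x $ l * u' n l k i x\<bar> \<le> B"
    and "\<And>k i x. (\<lambda>n. u n k i x) \<longlonglongrightarrow> vort k i x"
    and "\<And>k i x. (\<lambda>n. \<Sum>l\<in>UNIV. W x $ l * u' n l k i x) \<longlonglongrightarrow> transport_rate k i x"
proof -
  obtain \<rho> :: "real^'n \<Rightarrow> real" and \<rho>1 \<rho>2
    where k: "continuous_on UNIV \<rho>" "\<And>i. continuous_on UNIV (\<rho>1 i)" "\<And>i j. continuous_on UNIV (\<rho>2 i j)"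
      "\<And>i. has_partial \<rho> i (\<rho>1 i)" "\<And>i j. has_partial (\<rho>1 i) j (\<rho>2 i j)"
      "\<And>i j. \<rho>2 i j = \<rho>2 j i" "zero_outside 1 \<rho>" and one: "integral\<^sup>L lborel \<rho> = 1"
    using smooth_kernel_exists by blast
  define e where "e = (\<lambda>n. inverse (real (Suc n)))"
  have e: "e n > 0" "e n \<noteq> 0" for n unfolding e_def by auto
  define u where "u = (\<lambda>n k i. mollify \<rho> (e n) (vort k i))"
  define u' where "u' = (\<lambda>n l k i x. mollify (\<rho>1 l) (e n) (vort k i) x / e n)"
  define B1 where "B1 = (LINT z|lborel. 2 * L * \<bar>\<rho> z\<bar>)"
  define B2 where "B2 = (\<lambda>l. LINT z|lborel. L * norm z * (2 * L) * \<bar>\<rho>1 l z\<bar>)"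
  define B where "B = B1 + \<bar>c\<bar> * B1 + (\<Sum>k\<in>UNIV. \<Sum>i\<in>UNIV. \<Sum>j\<in>(UNIV::'n set). B2 k + B2 i)"
  have B1: "0 \<le> B1" and B2: "0 \<le> B2 l" for l
    unfolding B1_def B2_def using L_nonneg by (auto intro!: Bochner_Integration.integral_nonneg)
  have eq: "(\<Sum>l\<in>UNIV. W x $ l * u' n l k i x) = - (c * u n k i x)
      - (\<Sum>j\<in>UNIV. commutator \<rho>1 k j j i (e n) x + commutator \<rho>1 i j k j (e n) x)" for n k i x
    unfolding u_def u'_def by (rule mollified_transport[OF k e(2)])
  show ?thesis
  proof (rule that[of u u' B])
    show "has_partial (u n k i) l (u' n l k i)" for n k i l
      unfolding u_def u'_def by (rule has_partial_mollify_vort[OF k e(2)])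
    show "continuous_on UNIV (u n k i)" for n k i
      unfolding u_def by (rule continuous_on_mollify[OF continuous_vort k(1,7)])
    show "continuous_on UNIV (u' n l k i)" for n l k i
      unfolding u'_def
      by (intro continuous_intros continuous_on_mollify[OF continuous_vort k(2) zero_outside_partial[OF k(4,7)]])
        (use e in auto)
    have ub: "\<bar>u n k i x\<bar> \<le> B1" for n k i x
      unfolding u_def B1_def by (rule mollify_vort_bound[OF k])
    have S0: "0 \<le> (\<Sum>k\<in>UNIV. \<Sum>i\<in>UNIV. \<Sum>j\<in>(UNIV::'n set). B2 k + B2 i)"
      by (intro sum_nonneg add_nonneg_nonneg B2)
    show "\<bar>u n k i x\<bar> \<le> B" for n k i x
      using ub[of n k i x] S0 B1 mult_nonneg_nonneg[of "\<bar>c\<bar>" B1] unfolding B_def by linarith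
    have cb: "\<bar>commutator \<rho>1 l j p q (e n) x\<bar> \<le> B2 l" for l j p q n x
      unfolding B2_def by (rule commutator_bound[OF k e(1)])
    show "\<bar>\<Sum>l\<in>UNIV. W x $ l * u' n l k i x\<bar> \<le> B" for n k i x
    proof -
      have "\<bar>\<Sum>j\<in>UNIV. commutator \<rho>1 k j j i (e n) x + commutator \<rho>1 i j k j (e n) x\<bar>
          \<le> (\<Sum>j\<in>(UNIV::'n set). B2 k + B2 i)"
        by (rule order_trans[OF sum_abs], rule sum_mono, rule order_trans[OF abs_triangle_ineq])
          (intro add_mono cb)
      also have "\<dots> \<le> (\<Sum>i\<in>UNIV. \<Sum>j\<in>(UNIV::'n set). B2 k + B2 i)"
        by (rule member_le_sum[of i UNIV "\<lambda>i. \<Sum>j\<in>(UNIV::'n set). B2 k + B2 i"])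
          (auto intro!: sum_nonneg mult_nonneg_nonneg add_nonneg_nonneg B2)
      also have "\<dots> \<le> (\<Sum>k\<in>UNIV. \<Sum>i\<in>UNIV. \<Sum>j\<in>(UNIV::'n set). B2 k + B2 i)"
        by (rule member_le_sum[of k UNIV "\<lambda>k. \<Sum>i\<in>UNIV. \<Sum>j\<in>(UNIV::'n set). B2 k + B2 i"])
          (auto intro!: sum_nonneg mult_nonneg_nonneg add_nonneg_nonneg B2)
      finally have 1: "\<bar>\<Sum>j\<in>UNIV. commutator \<rho>1 k j j i (e n) x + commutator \<rho>1 i j k j (e n) x\<bar>
        \<le> (\<Sum>k\<in>UNIV. \<Sum>i\<in>UNIV. \<Sum>j\<in>(UNIV::'n set). B2 k + B2 i)" .
      have "\<bar>c * u n k i x\<bar> \<le> \<bar>c\<bar> * B1"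
        unfolding abs_mult by (intro mult_left_mono ub) simp
      with 1 B1 show ?thesis unfolding eq B_def by linarith
    qed
    show lim: "(\<lambda>n. u n k i x) \<longlonglongrightarrow> vort k i x" for k i x
      unfolding u_def e_def by (rule mollify_vort_limit[OF k one])
    show "(\<lambda>n. \<Sum>l\<in>UNIV. W x $ l * u' n l k i x) \<longlonglongrightarrow> transport_rate k i x" for k i x
      unfolding eq transport_rate_def e_def
      by (intro tendsto_intros lim commutator_limit[OF k one])
  qed
qed

section \<open>Renormalisation\<close>

definition vort_sq :: "real^'n \<Rightarrow> real" where
  "vort_sq x = (\<Sum>k\<in>UNIV. \<Sum>i\<in>UNIV. vort k i x * vort k i x)"

definition vort_sq_rate :: "real^'n \<Rightarrow> real" where
  "vort_sq_rate x = (\<Sum>k\<in>UNIV. \<Sum>i\<in>UNIV. 2 * vort k i x * transport_rate k i x)"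

lemma vort_sq_nonneg: "0 \<le> vort_sq x"
  unfolding vort_sq_def by (intro sum_nonneg) simp

lemma continuous_vort_sq: "continuous_on UNIV vort_sq"
  unfolding vort_sq_def by (intro continuous_intros continuous_vort)

lemma continuous_vort_sq_rate: "continuous_on UNIV vort_sq_rate"
  unfolding vort_sq_rate_def by (intro continuous_intros continuous_vort continuous_transport_rate)

text \<open>The integral of \<open>div (\<phi> G(S) W)\<close> over the whole space vanishes; expand the divergence, where \<open>div W = d\<close>.\<close>

lemma regularised_identity:
  fixes w :: "'n \<Rightarrow> 'n \<Rightarrow> real^'n \<Rightarrow> real"
  assumes w: "\<And>k i l. has_partial (w k i) l (w' l k i)"
      "\<And>k i. continuous_on UNIV (w k i)" "\<And>k i l. continuous_on UNIV (w' l k i)"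
    and \<phi>: "\<And>i. has_partial \<phi> i (\<phi>' i)" "continuous_on UNIV \<phi>" "\<And>i. continuous_on UNIV (\<phi>' i)"
      "zero_outside r \<phi>"
    and G: "\<And>s. 0 \<le> s \<Longrightarrow> (G has_real_derivative G' s) (at s)" "continuous_on {0..} G'"
  defines "S \<equiv> \<lambda>x. \<Sum>k\<in>UNIV. \<Sum>i\<in>UNIV. w k i x * w k i x"
  shows "(LINT x|lborel. (\<Sum>i\<in>UNIV. W x $ i * \<phi>' i x) * G (S x) + \<phi> x * (d * G (S x) + G' (S x) *
      (\<Sum>k\<in>UNIV. \<Sum>i\<in>UNIV. 2 * w k i x * (\<Sum>l\<in>UNIV. W x $ l * w' l k i x)))) = 0"
    and "continuous_on UNIV (\<lambda>x. (\<Sum>i\<in>UNIV. W x $ i * \<phi>' i x) * G (S x) + \<phi> x * (d * G (S x) + G' (S x) *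
      (\<Sum>k\<in>UNIV. \<Sum>i\<in>UNIV. 2 * w k i x * (\<Sum>l\<in>UNIV. W x $ l * w' l k i x))))"
proof -
  have S0: "0 \<le> S x" for x unfolding S_def by (intro sum_nonneg) simp
  have cS: "continuous_on UNIV S" unfolding S_def by (intro continuous_intros w)
  have "continuous_on {0..} G"
    using G(1) by (auto intro!: continuous_at_imp_continuous_on DERIV_isCont)
  then have cG: "continuous_on UNIV (\<lambda>x. G (S x))" "continuous_on UNIV (\<lambda>x. G' (S x))"
    using S0 by (auto intro!: continuous_on_compose2[OF _ cS] G(2))
  define S' where "S' = (\<lambda>l x. \<Sum>k\<in>UNIV. \<Sum>i\<in>UNIV. w' l k i x * w k i x + w k i x * w' l k i x)"
  have cS': "continuous_on UNIV (S' l)" for l unfolding S'_def by (intro continuous_intros w)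
  have S': "has_partial S l (S' l)" for l
    unfolding S_def S'_def by (intro has_partial_sum has_partial_mult w)
  have GS: "has_partial (\<lambda>x. G (S x)) l (\<lambda>x. G' (S x) * S' l x)" for l
    by (rule has_partial_compose[OF S' G(1)[OF S0]])
  define H where "H = (\<lambda>l x. \<phi>' l x * (W x $ l * G (S x)) + \<phi> x * (dW l l x * G (S x) + W x $ l * (G' (S x) * S' l x)))"
  have cH: "continuous_on UNIV (H l)" for l
    unfolding H_def by (intro continuous_intros \<phi> cG cS' continuous_W continuous_dW)
  have H: "has_partial (\<lambda>x. \<phi> x * (W x $ l * G (S x))) l (H l)" for l
    unfolding H_def by (intro has_partial_mult \<phi> has_partial_W GS)
  have z: "zero_outside r (\<lambda>x. \<phi> x * (W x $ l * G (S x)))" for l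
    using \<phi>(4) by (simp add: zero_outside_def)
  have "integral\<^sup>L lborel (H l) = 0" for l
    by (rule integral_partial_eq_0[OF H _ cH z]) (intro continuous_intros \<phi> cG continuous_W)
  moreover have "integrable lborel (H l)" for l
    by (rule integral_zero_outside(1)[OF cH zero_outside_partial[OF H z]])
  ultimately have sum0: "(LINT x|lborel. (\<Sum>l\<in>UNIV. H l x)) = 0"
    by simp
  have eq: "(\<Sum>l\<in>UNIV. H l x) = (\<Sum>i\<in>UNIV. W x $ i * \<phi>' i x) * G (S x) + \<phi> x * (d * G (S x) + G' (S x) *
      (\<Sum>k\<in>UNIV. \<Sum>i\<in>UNIV. 2 * w k i x * (\<Sum>l\<in>UNIV. W x $ l * w' l k i x)))" for x
  proof -
    have "(\<Sum>l\<in>UNIV. W x $ l * S' l x) = (\<Sum>l\<in>UNIV. \<Sum>k\<in>UNIV. \<Sum>i\<in>UNIV. 2 * w k i x * (W x $ l * w' l k i x))"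
      unfolding S'_def sum_distrib_left by (intro sum.cong refl) (simp add: algebra_simps)
    also have "\<dots> = (\<Sum>k\<in>UNIV. \<Sum>l\<in>UNIV. \<Sum>i\<in>UNIV. 2 * w k i x * (W x $ l * w' l k i x))"
      by (rule sum.swap)
    also have "\<dots> = (\<Sum>k\<in>UNIV. \<Sum>i\<in>UNIV. 2 * w k i x * (\<Sum>l\<in>UNIV. W x $ l * w' l k i x))"
      unfolding sum_distrib_left by (intro sum.cong refl sum.swap)
    finally have S'': "(\<Sum>l\<in>UNIV. W x $ l * S' l x) = \<dots>" .
    have "(\<Sum>l\<in>UNIV. H l x) = (\<Sum>i\<in>UNIV. W x $ i * \<phi>' i x) * G (S x)
      + \<phi> x * ((\<Sum>l\<in>UNIV. dW l l x) * G (S x) + G' (S x) * (\<Sum>l\<in>UNIV. W x $ l * S' l x))"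
      unfolding H_def by (simp add: sum.distrib sum_distrib_left sum_distrib_right algebra_simps)
    then show ?thesis
      unfolding S'' using div_W[of x] by (simp add: dW_def)
  qed
  show "(LINT x|lborel. (\<Sum>i\<in>UNIV. W x $ i * \<phi>' i x) * G (S x) + \<phi> x * (d * G (S x) + G' (S x) *
      (\<Sum>k\<in>UNIV. \<Sum>i\<in>UNIV. 2 * w k i x * (\<Sum>l\<in>UNIV. W x $ l * w' l k i x)))) = 0"
    using sum0 unfolding eq .
  show "continuous_on UNIV (\<lambda>x. (\<Sum>i\<in>UNIV. W x $ i * \<phi>' i x) * G (S x) + \<phi> x * (d * G (S x) + G' (S x) *
      (\<Sum>k\<in>UNIV. \<Sum>i\<in>UNIV. 2 * w k i x * (\<Sum>l\<in>UNIV. W x $ l * w' l k i x))))"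
    unfolding eq[symmetric] by (intro continuous_intros cH)
qed

text \<open>Apply \<open>regularised_identity\<close> to the approximations and pass to the limit. The square sums stay in a compact
  interval, on which \<open>G\<close> and its derivative are bounded, and \<open>\<phi>\<close> confines the integrals to a ball, so dominated
  convergence applies.\<close>

lemma renormalised_identity:
  assumes \<phi>: "\<And>i. has_partial \<phi> i (\<phi>' i)" "continuous_on UNIV \<phi>" "\<And>i. continuous_on UNIV (\<phi>' i)"
      "zero_outside r \<phi>"
    and G: "\<And>s. 0 \<le> s \<Longrightarrow> (G has_real_derivative G' s) (at s)" "continuous_on {0..} G'"
  shows "(LINT x|lborel. (\<Sum>i\<in>UNIV. W x $ i * \<phi>' i x) * G (vort_sq x)
      + \<phi> x * (d * G (vort_sq x) + G' (vort_sq x) * vort_sq_rate x)) = 0"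
proof -
  obtain u :: "nat \<Rightarrow> 'n \<Rightarrow> 'n \<Rightarrow> real^'n \<Rightarrow> real" and u' B
    where u: "\<And>n k i l. has_partial (u n k i) l (u' n l k i)"
      "\<And>n k i. continuous_on UNIV (u n k i)" "\<And>n k i l. continuous_on UNIV (u' n l k i)"
      and ub: "\<And>n k i x. \<bar>u n k i x\<bar> \<le> B"
      and Du: "\<And>n k i x. \<bar>\<Sum>l\<in>UNIV. W x $ l * u' n l k i x\<bar> \<le> B"
      and lim: "\<And>k i x. (\<lambda>n. u n k i x) \<longlonglongrightarrow> vort k i x"
      "\<And>k i x. (\<lambda>n. \<Sum>l\<in>UNIV. W x $ l * u' n l k i x) \<longlonglongrightarrow> transport_rate k i x"
    using vorticity_approximation by blast
  define D where "D = (\<lambda>n k i x. \<Sum>l\<in>UNIV. W x $ l * u' n l k i x)"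
  define S where "S = (\<lambda>n x. \<Sum>k\<in>UNIV. \<Sum>i\<in>UNIV. u n k i x * u n k i x)"
  define R where "R = (\<lambda>n x. \<Sum>k\<in>UNIV. \<Sum>i\<in>UNIV. 2 * u n k i x * D n k i x)"
  define E where "E = (\<lambda>x. \<Sum>i\<in>UNIV. W x $ i * \<phi>' i x)"
  have cE: "continuous_on UNIV E" unfolding E_def by (intro continuous_intros continuous_W \<phi>)
  have zE: "zero_outside r E"
    using zero_outside_partial[OF \<phi>(1,4)] unfolding E_def zero_outside_def by simp
  have B0: "0 \<le> B" using ub[of 0 undefined undefined 0] by linarith
  define M where "M = (\<Sum>k\<in>(UNIV::'n set). \<Sum>i\<in>(UNIV::'n set). B * B)"
  define M' where "M' = (\<Sum>k\<in>(UNIV::'n set). \<Sum>i\<in>(UNIV::'n set). 2 * B * B)"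
  have S0: "0 \<le> S n x" for n x unfolding S_def by (intro sum_nonneg) simp
  have SM: "S n x \<le> M" for n x
    unfolding S_def M_def
  proof (intro sum_mono)
    fix k i
    have "\<bar>u n k i x\<bar> * \<bar>u n k i x\<bar> \<le> B * B" by (intro mult_mono ub B0) simp
    then show "u n k i x * u n k i x \<le> B * B" by (simp add: abs_mult_self_eq)
  qed
  have RM: "\<bar>R n x\<bar> \<le> M'" for n x
    unfolding R_def M'_def
  proof (rule order_trans[OF sum_abs], rule sum_mono, rule order_trans[OF sum_abs], rule sum_mono)
    fix k i
    show "\<bar>2 * u n k i x * D n k i x\<bar> \<le> 2 * B * B"
      unfolding abs_mult D_def using ub[of n k i x] Du[where n = n and k = k and i = i and x = x] B0
      by (intro mult_mono) auto
  qed
  have cG: "continuous_on {0..} G"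
    using G(1) by (auto intro!: continuous_at_imp_continuous_on DERIV_isCont)
  have "compact (G ` {0..M})" "compact (G' ` {0..M})"
    by (intro compact_continuous_image continuous_on_subset[OF cG] continuous_on_subset[OF G(2)]; auto)+
  then have "bounded (G ` {0..M})" "bounded (G' ` {0..M})"
    by (simp_all add: compact_imp_bounded)
  then obtain K0 K1 where K: "\<And>s. s \<in> {0..M} \<Longrightarrow> \<bar>G s\<bar> \<le> K0" "\<And>s. s \<in> {0..M} \<Longrightarrow> \<bar>G' s\<bar> \<le> K1"
    unfolding bounded_iff by (metis imageI real_norm_def)
  define I where "I = (\<lambda>n x. E x * G (S n x) + \<phi> x * (d * G (S n x) + G' (S n x) * R n x))"
  have I: "integral\<^sup>L lborel (I n) = 0" "continuous_on UNIV (I n)" for n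
    unfolding I_def E_def S_def R_def D_def
    by (rule regularised_identity[OF u \<phi> G]; assumption)+
  have "(\<lambda>n. integral\<^sup>L lborel (I n)) \<longlonglongrightarrow> (LINT x|lborel. E x * G (vort_sq x)
      + \<phi> x * (d * G (vort_sq x) + G' (vort_sq x) * vort_sq_rate x))"
  proof (rule integral_dominated_convergence)
    show "integrable lborel (\<lambda>x. \<bar>E x\<bar> * K0 + \<bar>\<phi> x\<bar> * (\<bar>d\<bar> * K0 + K1 * M'))"
      by (rule integral_zero_outside(1)[of _ r])
        (use zE \<phi>(4) in \<open>auto simp: zero_outside_def intro!: continuous_intros cE \<phi>(2)\<close>)
    have "continuous_on UNIV (\<lambda>x. G (vort_sq x))" "continuous_on UNIV (\<lambda>x. G' (vort_sq x))"
      using vort_sq_nonneg by (auto intro!: continuous_on_compose2[OF _ continuous_vort_sq] G(2) cG)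
    then show "(\<lambda>x. E x * G (vort_sq x) + \<phi> x * (d * G (vort_sq x) + G' (vort_sq x) * vort_sq_rate x))
        \<in> borel_measurable lborel"
      by (intro borel_measurable_lborel_continuous continuous_intros cE \<phi>(2) continuous_vort_sq_rate)
    show "I n \<in> borel_measurable lborel" for n
      by (rule borel_measurable_lborel_continuous[OF I(2)])
    have "\<bar>I n x\<bar> \<le> \<bar>E x\<bar> * K0 + \<bar>\<phi> x\<bar> * (\<bar>d\<bar> * K0 + K1 * M')" for n x
    proof -
      have GK: "\<bar>G (S n x)\<bar> \<le> K0" "\<bar>G' (S n x)\<bar> \<le> K1"
        using K[of "S n x"] S0[of n x] SM[of n x] by auto
      have "0 \<le> K1" using GK(2) by linarith
      have "\<bar>d * G (S n x) + G' (S n x) * R n x\<bar> \<le> \<bar>d\<bar> * K0 + K1 * M'"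
        by (rule order_trans[OF abs_triangle_ineq], unfold abs_mult)
          (intro add_mono mult_left_mono mult_mono GK RM \<open>0 \<le> K1\<close> abs_ge_zero)
      then show ?thesis
        unfolding I_def
        by (intro order_trans[OF abs_triangle_ineq], unfold abs_mult)
          (intro add_mono mult_left_mono GK abs_ge_zero)
    qed
    then show "AE x in lborel. norm (I n x) \<le> \<bar>E x\<bar> * K0 + \<bar>\<phi> x\<bar> * (\<bar>d\<bar> * K0 + K1 * M')" for n
      by simp
    have "(\<lambda>n. I n x) \<longlonglongrightarrow> E x * G (vort_sq x)
      + \<phi> x * (d * G (vort_sq x) + G' (vort_sq x) * vort_sq_rate x)" for x
    proof -
      have S: "(\<lambda>n. S n x) \<longlonglongrightarrow> vort_sq x"
        unfolding S_def vort_sq_def by (intro tendsto_intros lim)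
      have "(\<lambda>n. R n x) \<longlonglongrightarrow> vort_sq_rate x"
        unfolding R_def vort_sq_rate_def D_def by (intro tendsto_intros lim)
      moreover have "(\<lambda>n. G (S n x)) \<longlonglongrightarrow> G (vort_sq x)" "(\<lambda>n. G' (S n x)) \<longlonglongrightarrow> G' (vort_sq x)"
        by (rule continuous_on_tendsto_compose[OF cG S] continuous_on_tendsto_compose[OF G(2) S];
            use S0 vort_sq_nonneg in auto)+
      ultimately show ?thesis
        unfolding I_def by (intro tendsto_intros)
    qed
    then show "AE x in lborel. (\<lambda>n. I n x) \<longlonglongrightarrow> E x * G (vort_sq x)
      + \<phi> x * (d * G (vort_sq x) + G' (vort_sq x) * vort_sq_rate x)" by simp
  qed
  then have "(LINT x|lborel. E x * G (vort_sq x)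
      + \<phi> x * (d * G (vort_sq x) + G' (vort_sq x) * vort_sq_rate x)) = 0"
    unfolding I(1) LIMSEQ_const_iff by (rule sym)
  then show ?thesis unfolding E_def .
qed

section \<open>Vanishing of the vorticity\<close>

text \<open>The rate is linear in \<open>vort\<close> with bounded coefficients. That \<open>C\<close> depends on neither the exponent nor the point is
  what the final comparison rests on.\<close>

lemma vort_sq_rate_bound:
  obtains C where "C \<ge> 0" "\<And>x. \<bar>vort_sq_rate x\<bar> \<le> C * vort_sq x"
proof -
  define N where "N = real CARD('n)"
  define K where "K = \<bar>c\<bar> + N * (2 * L)"
  have K0: "0 \<le> K" unfolding K_def N_def using L_nonneg by simp
  have v: "\<bar>vort k i x\<bar> \<le> sqrt (vort_sq x)" for k i x
  proof -
    have "vort k i x * vort k i x \<le> (\<Sum>i\<in>UNIV. vort k i x * vort k i x)"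
      by (rule member_le_sum[of i UNIV "\<lambda>i. vort k i x * vort k i x"]) auto
    also have "\<dots> \<le> vort_sq x"
      unfolding vort_sq_def
      by (rule member_le_sum[of k UNIV "\<lambda>k. \<Sum>i\<in>UNIV. vort k i x * vort k i x"]) (auto intro!: sum_nonneg)
    finally have "(vort k i x)\<^sup>2 \<le> vort_sq x" by (simp add: power2_eq_square)
    then show ?thesis by (rule real_le_rsqrt[of "\<bar>vort k i x\<bar>", simplified])
  qed
  have t: "\<bar>transport_rate k i x\<bar> \<le> K * sqrt (vort_sq x)" for k i x
  proof -
    let ?s = "sqrt (vort_sq x)"
    have dv: "\<bar>dW l j x * vort p q x\<bar> \<le> L * ?s" for l j p q
      unfolding abs_mult by (intro mult_mono dW_bound v L_nonneg) simp
    have "\<bar>\<Sum>j\<in>UNIV. dW k j x * vort j i x + dW i j x * vort k j x\<bar> \<le> (\<Sum>j\<in>(UNIV::'n set). L * ?s + L * ?s)"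
      by (rule order_trans[OF sum_abs], rule sum_mono, rule order_trans[OF abs_triangle_ineq])
        (intro add_mono dv)
    moreover have "\<bar>c * vort k i x\<bar> \<le> \<bar>c\<bar> * ?s"
      unfolding abs_mult by (intro mult_left_mono v) simp
    moreover have "K * ?s = \<bar>c\<bar> * ?s + (\<Sum>j\<in>(UNIV::'n set). L * ?s + L * ?s)"
      unfolding K_def N_def by (simp add: algebra_simps)
    ultimately show ?thesis unfolding transport_rate_def by linarith
  qed
  show ?thesis
  proof (rule that[of "N * (N * (2 * K))"])
    show "0 \<le> N * (N * (2 * K))" using K0 by (simp add: N_def)
    fix x
    let ?s = "sqrt (vort_sq x)"
    have "\<bar>2 * vort k i x * transport_rate k i x\<bar> \<le> 2 * ?s * (K * ?s)" for k i
      unfolding abs_mult using v[of k i x] t[of k i x] vort_sq_nonneg[of x] by (intro mult_mono) auto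
    then have "\<bar>vort_sq_rate x\<bar> \<le> (\<Sum>k\<in>(UNIV::'n set). \<Sum>i\<in>(UNIV::'n set). 2 * ?s * (K * ?s))"
      unfolding vort_sq_rate_def
      by (intro order_trans[OF sum_abs] sum_mono order_trans[OF sum_abs])
    also have "\<dots> = N * (N * (2 * K)) * vort_sq x"
      using vort_sq_nonneg[of x] by (simp add: N_def)
    finally show "\<bar>vort_sq_rate x\<bar> \<le> N * (N * (2 * K)) * vort_sq x" .
  qed
qed

text \<open>The gradient of the cutoff at radius \<open>R\<close> is of order \<open>|x|/R\<^sup>2\<close> on the ball of radius \<open>R\<close>, and \<open>W\<close> grows at most
  linearly. Hence the flux through the cutoff is bounded uniformly in \<open>R\<close> and tends to zero at each point.\<close>

lemma cutoff_exists:
  obtains \<phi> :: "nat \<Rightarrow> real^'n \<Rightarrow> real" and \<phi>' r K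
  where "\<And>n i. has_partial (\<phi> n) i (\<phi>' n i)" "\<And>n. continuous_on UNIV (\<phi> n)"
    and "\<And>n i. continuous_on UNIV (\<phi>' n i)" "\<And>n. zero_outside (r n) (\<phi> n)"
    and "\<And>n x. 0 \<le> \<phi> n x" "\<And>n x. \<phi> n x \<le> 1" "\<And>x. (\<lambda>n. \<phi> n x) \<longlonglongrightarrow> 1"
    and "\<And>n x. \<bar>\<Sum>i\<in>UNIV. W x $ i * \<phi>' n i x\<bar> \<le> K"
    and "\<And>x. (\<lambda>n. \<Sum>i\<in>UNIV. W x $ i * \<phi>' n i x) \<longlonglongrightarrow> 0"
proof -
  define r where "r = (\<lambda>n. real (Suc n))"
  have r: "1 \<le> r n" "0 < r n" "r n \<noteq> 0" for n unfolding r_def by auto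
  have rlim: "(\<lambda>n. a / (r n)\<^sup>2) \<longlonglongrightarrow> 0" for a
  proof -
    have "(\<lambda>n. a * (inverse (real (Suc n)))\<^sup>2) \<longlonglongrightarrow> a * 0\<^sup>2"
      by (intro tendsto_intros LIMSEQ_inverse_real_of_nat)
    then show ?thesis by (simp add: r_def divide_inverse power_inverse)
  qed
  define b where "b = (\<lambda>n x::real^'n. max 0 (1 - (norm x)\<^sup>2 / (r n)\<^sup>2))"
  define \<phi> where "\<phi> = (\<lambda>n x. b n x ^ Suc (Suc 0))"
  define \<phi>' where "\<phi>' = (\<lambda>n i x. real (Suc (Suc 0)) * b n x ^ Suc 0 * (- 2 / (r n)\<^sup>2 * x $ i))"
  have b: "0 \<le> b n x" "b n x \<le> 1" for n x unfolding b_def by auto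
  have bz: "b n x = 0" if "r n < norm x" for n x
  proof -
    have "(r n)\<^sup>2 \<le> (norm x)\<^sup>2" using that r(2)[of n] by (intro power_mono) auto
    then show ?thesis unfolding b_def using r(2)[of n] by (simp add: max_def field_simps)
  qed
  have cb: "continuous_on UNIV (b n)" for n
    unfolding b_def using r(3)[of n] by (intro continuous_intros) auto
  define N where "N = real CARD('n)"
  define A where "A = norm (W 0)"
  have Wb: "\<bar>W x $ i\<bar> \<le> A + L * norm x" for x i
  proof -
    have "norm (W x) \<le> norm (W x - W 0) + norm (W 0)" using norm_triangle_ineq[of "W x - W 0" "W 0"] by simp
    then show ?thesis
      using W_lipschitz[of x 0] component_le_norm_cart[of "W x" i] unfolding A_def by simp
  qed
  have E: "\<bar>\<Sum>i\<in>UNIV. W x $ i * \<phi>' n i x\<bar> \<le> N * ((A + L * norm x) * (4 * b n x * norm x / (r n)\<^sup>2))" for n x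
  proof -
    have "\<bar>W x $ i * \<phi>' n i x\<bar> \<le> (A + L * norm x) * (4 * b n x * norm x / (r n)\<^sup>2)" for i
    proof -
      have "\<bar>\<phi>' n i x\<bar> = 4 * b n x * \<bar>x $ i\<bar> / (r n)\<^sup>2"
        unfolding \<phi>'_def using b(1)[of n x] by (simp add: abs_mult)
      also have "\<dots> \<le> 4 * b n x * norm x / (r n)\<^sup>2"
        using b(1)[of n x] component_le_norm_cart[of x i] by (intro divide_right_mono mult_left_mono) auto
      finally show ?thesis
        unfolding abs_mult by (intro mult_mono Wb) (auto simp: A_def L_nonneg)
    qed
    then have "\<bar>\<Sum>i\<in>UNIV. W x $ i * \<phi>' n i x\<bar> \<le> (\<Sum>i\<in>(UNIV::'n set). (A + L * norm x) * (4 * b n x * norm x / (r n)\<^sup>2))"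
      by (intro order_trans[OF sum_abs] sum_mono)
    then show ?thesis by (simp add: N_def)
  qed
  show ?thesis
  proof (rule that[of \<phi> \<phi>' r "N * ((A + L) * 4)"])
    show "has_partial (\<phi> n) i (\<phi>' n i)" for n i
      unfolding \<phi>_def \<phi>'_def b_def by (rule has_partial_bump) (use r(3)[of n] in simp)
    show "continuous_on UNIV (\<phi> n)" "continuous_on UNIV (\<phi>' n i)" for n i
      unfolding \<phi>_def \<phi>'_def by (intro continuous_intros cb)+
    show "zero_outside (r n) (\<phi> n)" for n
      unfolding zero_outside_def \<phi>_def using bz by simp
    show "0 \<le> \<phi> n x" "\<phi> n x \<le> 1" for n x
      unfolding \<phi>_def using b[of n x] by (auto intro!: power_le_one simp del: power_Suc)
    show "(\<lambda>n. \<phi> n x) \<longlonglongrightarrow> 1" for x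
    proof -
      have "(\<lambda>n. (max 0 (1 - (norm x)\<^sup>2 / (r n)\<^sup>2)) ^ Suc (Suc 0)) \<longlonglongrightarrow> (max 0 (1 - 0)) ^ Suc (Suc 0)"
        by (intro tendsto_intros rlim)
      then show ?thesis unfolding \<phi>_def b_def by simp
    qed
    show "\<bar>\<Sum>i\<in>UNIV. W x $ i * \<phi>' n i x\<bar> \<le> N * ((A + L) * 4)" for n x
    proof (rule order_trans[OF E], rule mult_left_mono)
      show "0 \<le> N" by (simp add: N_def)
      show "(A + L * norm x) * (4 * b n x * norm x / (r n)\<^sup>2) \<le> (A + L) * 4"
      proof (cases "r n < norm x")
        case True
        then show ?thesis using bz[OF True] L_nonneg by (simp add: A_def)
      next
        case False
        have "A + L * norm x \<le> A * r n + L * r n"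
          using False r(1)[of n] L_nonneg mult_left_mono[of 1 "r n" A]
          by (intro add_mono mult_left_mono) (auto simp: A_def)
        moreover have "4 * b n x * norm x / (r n)\<^sup>2 \<le> 4 * 1 * r n / (r n)\<^sup>2"
          using False b[of n x] r(2)[of n] by (intro divide_right_mono mult_mono) auto
        ultimately have "(A + L * norm x) * (4 * b n x * norm x / (r n)\<^sup>2) \<le> (A * r n + L * r n) * (4 * 1 * r n / (r n)\<^sup>2)"
          using b(1)[of n x] r(2)[of n] L_nonneg by (intro mult_mono) (auto simp: A_def)
        also have "\<dots> = (A + L) * 4" using r(3)[of n] by (simp add: field_simps power2_eq_square)
        finally show ?thesis .
      qed
    qed
    show "(\<lambda>n. \<Sum>i\<in>UNIV. W x $ i * \<phi>' n i x) \<longlonglongrightarrow> 0" for x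
    proof (rule Lim_null_comparison)
      have "norm (\<Sum>i\<in>UNIV. W x $ i * \<phi>' n i x) \<le> N * ((A + L * norm x) * (4 * norm x)) / (r n)\<^sup>2" for n
      proof -
        have "N * ((A + L * norm x) * (4 * b n x * norm x / (r n)\<^sup>2)) \<le> N * ((A + L * norm x) * (4 * 1 * norm x / (r n)\<^sup>2))"
          using b[of n x] L_nonneg by (intro mult_left_mono divide_right_mono mult_right_mono) (auto simp: N_def A_def)
        with E[of x n] show ?thesis by simp
      qed
      then show "\<forall>\<^sub>F n in sequentially. norm (\<Sum>i\<in>UNIV. W x $ i * \<phi>' n i x) \<le> N * ((A + L * norm x) * (4 * norm x)) / (r n)\<^sup>2"
        by simp
    qed (rule rlim)
  qed
qed

text \<open>The function \<open>s powr q\<close> is not differentiable at \<open>0\<close>, so \<open>G n\<close> shifts it by \<open>e n\<close>. The shifted function stays below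
  \<open>s powr q\<close>, and \<open>s\<close> times its derivative stays below \<open>q * s powr q\<close>: the factor \<open>q\<close> survives in the limit. The shift
  and the cutoff are removed together.\<close>

lemma powr_integral_estimate:
  assumes q: "0 < q" "q \<le> 1" and int: "integrable lborel (\<lambda>x. vort_sq x powr q)"
    and C: "\<And>x. \<bar>vort_sq_rate x\<bar> \<le> C * vort_sq x"
  shows "\<bar>d\<bar> * (LINT x|lborel. vort_sq x powr q) \<le> q * C * (LINT x|lborel. vort_sq x powr q)"
proof -
  obtain \<phi> :: "nat \<Rightarrow> real^'n \<Rightarrow> real" and \<phi>' r K
    where \<phi>: "\<And>n i. has_partial (\<phi> n) i (\<phi>' n i)" "\<And>n. continuous_on UNIV (\<phi> n)"
     "\<And>n i. continuous_on UNIV (\<phi>' n i)" "\<And>n. zero_outside (r n) (\<phi> n)"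
     and \<phi>b: "\<And>n x. 0 \<le> \<phi> n x" "\<And>n x. \<phi> n x \<le> 1" and \<phi>lim: "\<And>x. (\<lambda>n. \<phi> n x) \<longlonglongrightarrow> 1"
     and E: "\<And>n x. \<bar>\<Sum>i\<in>UNIV. W x $ i * \<phi>' n i x\<bar> \<le> K"
     "\<And>x. (\<lambda>n. \<Sum>i\<in>UNIV. W x $ i * \<phi>' n i x) \<longlonglongrightarrow> 0"
    using cutoff_exists by blast
  define E where "E = (\<lambda>n x. \<Sum>i\<in>UNIV. W x $ i * \<phi>' n i x)"
  define e where "e = (\<lambda>n. inverse (real (Suc n)))"
  have e: "0 < e n" for n unfolding e_def by simp
  have elim: "e \<longlonglongrightarrow> 0" unfolding e_def by (rule LIMSEQ_inverse_real_of_nat)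
  define G where "G = (\<lambda>n s. (s + e n) powr q - e n powr q)"
  define G' where "G' = (\<lambda>n s. q * (s + e n) powr (q - 1))"
  have G: "(G n has_real_derivative G' n s) (at s)" if "0 \<le> s" for n s
    unfolding G_def G'_def using that e[of n]
    by (auto intro!: derivative_eq_intros)
  have cG': "continuous_on {0..} (G' n)" for n
    unfolding G'_def using e[of n] by (intro continuous_intros) (auto simp: add_nonneg_eq_0_iff)
  have cG: "continuous_on UNIV (\<lambda>x. G n (vort_sq x))" "continuous_on UNIV (\<lambda>x. G' n (vort_sq x))" for n
  proof -
    have "continuous_on {0..} (G n)"
      using G by (auto intro!: continuous_at_imp_continuous_on DERIV_isCont)
    then show "continuous_on UNIV (\<lambda>x. G n (vort_sq x))" "continuous_on UNIV (\<lambda>x. G' n (vort_sq x))"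
      using vort_sq_nonneg by (auto intro!: continuous_on_compose2[OF _ continuous_vort_sq] cG')
  qed
  have cE: "continuous_on UNIV (E n)" for n unfolding E_def by (intro continuous_intros continuous_W \<phi>)
  have zE: "zero_outside (r n) (E n)" for n
    using zero_outside_partial[OF \<phi>(1,4)] unfolding E_def zero_outside_def by simp
  let ?I = "LINT x|lborel. vort_sq x powr q"
  have Gb: "0 \<le> G n (vort_sq x)" "G n (vort_sq x) \<le> vort_sq x powr q" for n x
  proof -
    show "0 \<le> G n (vort_sq x)"
      unfolding G_def using q e[of n] vort_sq_nonneg[of x] by (simp add: powr_mono2)
    show "G n (vort_sq x) \<le> vort_sq x powr q"
      unfolding G_def using powr_add_le[OF vort_sq_nonneg e q(2), of x n] by simp
  qed
  have G'b: "\<bar>G' n (vort_sq x) * vort_sq_rate x\<bar> \<le> q * C * vort_sq x powr q" for n x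
  proof (cases "vort_sq x = 0")
    case True
    then show ?thesis using C[of x] by simp
  next
    case False
    then have S: "0 < vort_sq x" using vort_sq_nonneg[of x] by simp
    have C0: "0 \<le> C" using C[of x] S abs_ge_zero[of "vort_sq_rate x"]
      by (metis mult_less_0_iff not_le order_trans)
    have "(vort_sq x + e n) powr (q - 1) \<le> vort_sq x powr (q - 1)"
      using q e[of n] S by (intro powr_mono2') auto
    then have "\<bar>G' n (vort_sq x) * vort_sq_rate x\<bar> \<le> (q * vort_sq x powr (q - 1)) * (C * vort_sq x)"
      unfolding abs_mult G'_def using q C[of x] by (intro mult_mono) (auto simp: abs_mult)
    also have "\<dots> = q * C * (vort_sq x powr (q - 1) * vort_sq x powr 1)" using S by simp
    also have "\<dots> = q * C * vort_sq x powr q" by (simp only: powr_add[symmetric]) simp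
    finally show ?thesis .
  qed
  have Glim: "(\<lambda>n. G n (vort_sq x)) \<longlonglongrightarrow> vort_sq x powr q" for x
  proof -
    have "(\<lambda>n. (vort_sq x + e n) powr q - e n powr q) \<longlonglongrightarrow> (vort_sq x + 0) powr q - 0 powr q"
      using q vort_sq_nonneg[of x] e
      by (intro tendsto_intros tendsto_powr' elim) (auto intro!: always_eventually add_nonneg_nonneg less_imp_le)
    then show ?thesis unfolding G_def by simp
  qed
  have int1: "integrable lborel (\<lambda>x. E n x * G n (vort_sq x))"
      "integrable lborel (\<lambda>x. \<phi> n x * (G' n (vort_sq x) * vort_sq_rate x))"
      "integrable lborel (\<lambda>x. \<phi> n x * G n (vort_sq x))" for n
    by (rule integral_zero_outside(1)[of _ "r n"];
      use zE[of n] \<phi>(4)[of n] in \<open>auto simp: zero_outside_def intro!: continuous_intros cE cG \<phi>(2) continuous_vort_sq_rate\<close>)+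
  have int2: "integrable lborel (\<lambda>x. \<bar>E n x\<bar> * vort_sq x powr q)" for n
  proof (rule Bochner_Integration.integrable_bound)
    show "integrable lborel (\<lambda>x. K * vort_sq x powr q)" using int by simp
    show "(\<lambda>x. \<bar>E n x\<bar> * vort_sq x powr q) \<in> borel_measurable lborel"
      using borel_measurable_integrable[OF int] borel_measurable_lborel_continuous[OF cE[of n]] by measurable
    show "AE x in lborel. norm (\<bar>E n x\<bar> * vort_sq x powr q) \<le> norm (K * vort_sq x powr q)"
      using E(1)[of _ n] unfolding E_def
      by (intro AE_I2) (auto simp: abs_mult intro!: mult_right_mono intro: order_trans[OF _ abs_ge_self])
  qed
  have main: "\<bar>d\<bar> * (LINT x|lborel. \<phi> n x * G n (vort_sq x))
      \<le> (LINT x|lborel. \<bar>E n x\<bar> * vort_sq x powr q) + q * C * ?I" for n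
  proof -
    have "(LINT x|lborel. E n x * G n (vort_sq x)
      + \<phi> n x * (d * G n (vort_sq x) + G' n (vort_sq x) * vort_sq_rate x)) = 0"
      unfolding E_def by (rule renormalised_identity[OF \<phi> G cG'])
    moreover have "(\<lambda>x. E n x * G n (vort_sq x)
      + \<phi> n x * (d * G n (vort_sq x) + G' n (vort_sq x) * vort_sq_rate x))
      = (\<lambda>x. E n x * G n (vort_sq x) + (d * (\<phi> n x * G n (vort_sq x))
          + \<phi> n x * (G' n (vort_sq x) * vort_sq_rate x)))"
      by (simp add: algebra_simps)
    ultimately have eq: "d * (LINT x|lborel. \<phi> n x * G n (vort_sq x))
      = - (LINT x|lborel. E n x * G n (vort_sq x)) - (LINT x|lborel. \<phi> n x * (G' n (vort_sq x) * vort_sq_rate x))"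
      using int1[of n] by simp
    have 1: "\<bar>LINT x|lborel. E n x * G n (vort_sq x)\<bar> \<le> (LINT x|lborel. \<bar>E n x\<bar> * vort_sq x powr q)"
      by (rule integral_abs_bound_integral[OF int1(1) int2])
        (use Gb in \<open>auto simp: abs_mult intro!: mult_left_mono\<close>)
    have 2: "\<bar>LINT x|lborel. \<phi> n x * (G' n (vort_sq x) * vort_sq_rate x)\<bar> \<le> (LINT x|lborel. q * C * vort_sq x powr q)"
    proof (rule integral_abs_bound_integral[OF int1(2)])
      show "integrable lborel (\<lambda>x. q * C * vort_sq x powr q)" using int by simp
      fix x
      have "\<bar>\<phi> n x * (G' n (vort_sq x) * vort_sq_rate x)\<bar> \<le> 1 * \<bar>G' n (vort_sq x) * vort_sq_rate x\<bar>"
        unfolding abs_mult[of "\<phi> n x"] using \<phi>b[of n x] by (intro mult_right_mono) auto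
      with G'b[of n x] show "\<bar>\<phi> n x * (G' n (vort_sq x) * vort_sq_rate x)\<bar> \<le> q * C * vort_sq x powr q" by linarith
    qed
    have 3: "0 \<le> (LINT x|lborel. \<phi> n x * G n (vort_sq x))"
      using \<phi>b(1) Gb(1) by (intro Bochner_Integration.integral_nonneg) simp
    have "\<bar>d\<bar> * (LINT x|lborel. \<phi> n x * G n (vort_sq x)) = \<bar>d * (LINT x|lborel. \<phi> n x * G n (vort_sq x))\<bar>"
      using 3 by (simp add: abs_mult)
    also have "\<dots> \<le> (LINT x|lborel. \<bar>E n x\<bar> * vort_sq x powr q) + (LINT x|lborel. q * C * vort_sq x powr q)"
      using 1 2 unfolding eq by linarith
    finally show ?thesis by simp
  qed
  have "(\<lambda>n. LINT x|lborel. \<phi> n x * G n (vort_sq x)) \<longlonglongrightarrow> ?I"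
  proof (rule integral_dominated_convergence[OF _ _ int])
    show "(\<lambda>x. vort_sq x powr q) \<in> borel_measurable lborel" using int by (rule borel_measurable_integrable)
    show "(\<lambda>x. \<phi> n x * G n (vort_sq x)) \<in> borel_measurable lborel" for n
      using int1(3) by (rule borel_measurable_integrable)
    have "(\<lambda>n. \<phi> n x * G n (vort_sq x)) \<longlonglongrightarrow> 1 * vort_sq x powr q" for x
      by (intro tendsto_mult \<phi>lim Glim)
    then show "AE x in lborel. (\<lambda>n. \<phi> n x * G n (vort_sq x)) \<longlonglongrightarrow> vort_sq x powr q" by simp
    have "\<phi> n x * G n (vort_sq x) \<le> 1 * vort_sq x powr q" for n x
      using \<phi>b[of n x] Gb[of n x] by (intro mult_mono) auto
    then show "AE x in lborel. norm (\<phi> n x * G n (vort_sq x)) \<le> vort_sq x powr q" for n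
      using \<phi>b(1) Gb(1) by simp
  qed
  moreover have "(\<lambda>n. LINT x|lborel. \<bar>E n x\<bar> * vort_sq x powr q) \<longlonglongrightarrow> (LINT x::real^'n|lborel. (0::real))"
  proof (rule integral_dominated_convergence)
    show "integrable lborel (\<lambda>x. K * vort_sq x powr q)" using int by simp
    show "(\<lambda>x. \<bar>E n x\<bar> * vort_sq x powr q) \<in> borel_measurable lborel" for n
      using int2 by (rule borel_measurable_integrable)
    show "AE x in lborel. norm (\<bar>E n x\<bar> * vort_sq x powr q) \<le> K * vort_sq x powr q" for n
      using E(1)[of _ n] unfolding E_def
      by (intro AE_I2) (auto simp: abs_mult intro!: mult_right_mono)
    have "(\<lambda>n. \<bar>E n x\<bar> * vort_sq x powr q) \<longlonglongrightarrow> \<bar>0\<bar> * vort_sq x powr q" for x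
      using E(2)[of x] unfolding E_def by (intro tendsto_intros)
    then show "AE x in lborel. (\<lambda>n. \<bar>E n x\<bar> * vort_sq x powr q) \<longlonglongrightarrow> 0" by simp
  qed simp
  ultimately have "\<bar>d\<bar> * ?I \<le> (LINT x::real^'n|lborel. (0::real)) + q * C * ?I"
    by (intro LIMSEQ_le[OF tendsto_mult_left tendsto_add[OF _ tendsto_const]]) (use main in auto)
  then show ?thesis by simp
qed

text \<open>Choose \<open>q\<close> so small that \<open>q C < |d|\<close> in the preceding estimate.\<close>

theorem vort_sq_eq_0:
  assumes "d \<noteq> 0" "0 < q1" and int: "\<And>q. 0 < q \<Longrightarrow> q < q1 \<Longrightarrow> integrable lborel (\<lambda>x. vort_sq x powr q)"
  shows "vort_sq x = 0"
proof -
  obtain C where C: "C \<ge> 0" "\<And>x. \<bar>vort_sq_rate x\<bar> \<le> C * vort_sq x"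
    using vort_sq_rate_bound by blast
  define q where "q = min (min 1 (q1 / 2)) (\<bar>d\<bar> / (2 * (C + 1)))"
  have q: "0 < q" "q \<le> 1" "q < q1" using assms C(1) by (auto simp: q_def)
  have "q * C < \<bar>d\<bar>"
  proof -
    have "q * C \<le> \<bar>d\<bar> / (2 * (C + 1)) * C" using C(1) by (intro mult_right_mono) (auto simp: q_def)
    also have "\<dots> < \<bar>d\<bar>" using C(1) assms(1) by (simp add: field_simps add_nonneg_pos)
    finally show ?thesis .
  qed
  let ?I = "LINT x|lborel. vort_sq x powr q"
  have "\<bar>d\<bar> * ?I \<le> q * C * ?I"
    by (rule powr_integral_estimate[OF q(1,2) int[OF q(1,3)] C(2)])
  then have "(\<bar>d\<bar> - q * C) * ?I \<le> 0" by (simp add: algebra_simps)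
  then have "?I \<le> 0" using \<open>q * C < \<bar>d\<bar>\<close> by (simp add: mult_le_0_iff)
  moreover have "0 \<le> ?I" by (rule Bochner_Integration.integral_nonneg) simp
  ultimately have "?I = 0" by simp
  then have "AE x in lborel. vort_sq x powr q = 0"
    using integral_nonneg_eq_0_iff_AE[OF int[OF q(1,3)]] by simp
  then have "AE x in lborel. vort_sq x = 0" by eventually_elim simp
  then show ?thesis by (rule continuous_AE_zero_imp_zero[OF continuous_vort_sq])
qed

end

section \<open>The self-similar profile of an Euler solution\<close>

lemma partial_deriv_eq:
  assumes "(f has_derivative f') (at x)"
  shows "partial_deriv j f x = f' (axis j 1)"
  unfolding partial_deriv_def by (rule vector_derivative_at[OF has_vector_derivative_along_axis[OF assms]])

lemma partial_deriv_component_eq: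
  fixes f :: "real^3 \<Rightarrow> real^3"
  assumes "(f has_derivative f') (at x)"
  shows "partial_deriv j (\<lambda>y. f y $ i) x = f' (axis j 1) $ i"
  by (rule partial_deriv_eq[OF bounded_linear.has_derivative[OF bounded_linear_vec_nth assms]])

lemma curl_eq:
  assumes "(f has_derivative f') (at x)"
  shows "curl f x = vector [f' (axis 2 1) $ 3 - f' (axis 3 1) $ 2,
    f' (axis 3 1) $ 1 - f' (axis 1 1) $ 3, f' (axis 1 1) $ 2 - f' (axis 2 1) $ 1]"
  unfolding curl_def partial_deriv_component_eq[OF assms] ..

lemma euler_solution_gradient:
  assumes "euler_solution T v0 v p"
  shows "\<exists>G :: real \<Rightarrow> (real^3) \<Rightarrow>\<^sub>C ((real^3) \<Rightarrow>\<^sub>L (real^3)). continuous_on {0..<T} G \<and>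
    (\<forall>t\<in>{0..<T}. \<forall>x. ((\<lambda>y. v y t) has_derivative blinfun_apply (apply_bcontfun (G t) x)) (at x))"
  using assms unfolding euler_solution_def continuous_into_C1_def by blast

lemma self_similar_profile_eq:
  assumes "self_similar \<alpha> T V v" "0 < t" "t < T"
  shows "V y = (T - t) powr (\<alpha> / (\<alpha> + 1)) *\<^sub>R v ((T - t) powr (1 / (\<alpha> + 1)) *\<^sub>R y) t"
  using assms unfolding self_similar_def by simp

text \<open>Rescaling in space and amplitude contributes the factor \<open>(T - t)\<close> to the power \<open>a + b = 1\<close>. Thus \<open>V\<close> inherits
  differentiability, and a bounded gradient, from the solution at any single time.\<close>

lemma self_similar_profile_has_derivative:
  assumes "\<alpha> \<noteq> -1" "self_similar \<alpha> T V v" "0 < t" "t < T"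
    and "\<And>x. ((\<lambda>y. v y t) has_derivative D x) (at x)"
  shows "(V has_derivative (\<lambda>h. (T - t) *\<^sub>R D ((T - t) powr (1 / (\<alpha> + 1)) *\<^sub>R y) h)) (at y)"
proof -
  define a b where "a = (T - t) powr (\<alpha> / (\<alpha> + 1))" and "b = (T - t) powr (1 / (\<alpha> + 1))"
  have "\<alpha> / (\<alpha> + 1) + 1 / (\<alpha> + 1) = 1" using assms(1) by (simp add: field_simps)
  then have ab: "a * b = T - t"
    unfolding a_def b_def using assms(3,4) by (simp add: powr_add[symmetric])
  have "((\<lambda>y. b *\<^sub>R y) has_derivative (\<lambda>h. b *\<^sub>R h)) (at y)"
    by (auto intro!: derivative_eq_intros)
  from has_derivative_compose[OF this assms(5)]
  have "((\<lambda>y. a *\<^sub>R v (b *\<^sub>R y) t) has_derivative (\<lambda>h. a *\<^sub>R D (b *\<^sub>R y) (b *\<^sub>R h))) (at y)"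
    by (rule has_derivative_scaleR_right)
  moreover have "D x (b *\<^sub>R h) = b *\<^sub>R D x h" for x h
    using has_derivative_linear[OF assms(5)] by (simp add: linear_cmul)
  moreover have "V = (\<lambda>y. a *\<^sub>R v (b *\<^sub>R y) t)"
    using self_similar_profile_eq[OF assms(2-4)] unfolding a_def b_def by blast
  ultimately show ?thesis
    using ab unfolding b_def[symmetric] by simp
qed

text \<open>The momentum equation at one time \<open>t\<close> and at the point \<open>x = \<tau>\<^sup>b y\<close>. By self-similarity the time derivative is a
  combination of \<open>V y\<close> and \<open>V' y y\<close>; all terms carry the common factor \<open>\<tau>\<^sup>-\<^sup>a / \<tau>\<close>.\<close>

lemma profile_equation:
  fixes V :: "real^3 \<Rightarrow> real^3"
  assumes \<alpha>: "\<alpha> \<noteq> -1" and euler: "euler_solution T v0 v p" and ss: "self_similar \<alpha> T V v"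
    and t: "0 < t" "t < T" and V: "\<And>y. (V has_derivative V' y) (at y)"
  defines "\<tau> \<equiv> T - t" and "a \<equiv> \<alpha> / (\<alpha> + 1)" and "b \<equiv> 1 / (\<alpha> + 1)"
  shows "a *\<^sub>R V y + V' y (V y + b *\<^sub>R y) = - ((\<tau> * \<tau> powr a) *\<^sub>R grad (\<lambda>x. p x t) (\<tau> powr b *\<^sub>R y))"
proof -
  have \<tau>: "\<tau> > 0" using t by (simp add: \<tau>_def)
  have ab: "a + b = 1" using \<alpha> by (simp add: a_def b_def field_simps)
  define x where "x = \<tau> powr b *\<^sub>R y"
  have y: "y = \<tau> powr (- b) *\<^sub>R x" using \<tau> by (simp add: x_def powr_minus)
  have lin: "linear (V' y)" by (rule has_derivative_linear[OF V])
  have v: "v z s = (T - s) powr (- a) *\<^sub>R V ((T - s) powr (- b) *\<^sub>R z)" if "s \<in> {0<..<T}" for s z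
    using ss that unfolding self_similar_def a_def b_def by (simp add: powr_minus divide_inverse)
  have pw: "((\<lambda>s. (T - s) powr (- r)) has_real_derivative r * \<tau> powr (- r) / \<tau>) (at t)" for r
  proof -
    have "((\<lambda>u. u powr (- r)) has_real_derivative - r * \<tau> powr (- r - 1)) (at (T - t))"
      unfolding \<tau>_def by (rule has_real_derivative_powr) (use t in simp)
    moreover have "((\<lambda>s. T - s) has_real_derivative (0 - 1)) (at t)"
      by (intro derivative_intros)
    ultimately have "((\<lambda>s. (T - s) powr (- r)) has_real_derivative - r * \<tau> powr (- r - 1) * (0 - 1)) (at t)"
      by (rule DERIV_chain2[where f = "\<lambda>u. u powr (- r)" and g = "\<lambda>s. T - s"])
    then show ?thesis using \<tau> by (simp add: powr_diff)
  qed
  have "((\<lambda>s. (T - s) powr (- b) *\<^sub>R x) has_vector_derivative (b * \<tau> powr (- b) / \<tau>) *\<^sub>R x) (at t)"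
    using has_vector_derivative_scaleR[OF pw has_vector_derivative_const[of x]] by simp
  then have "((\<lambda>s. (T - s) powr (- b) *\<^sub>R x) has_derivative (\<lambda>h. h *\<^sub>R ((b * \<tau> powr (- b) / \<tau>) *\<^sub>R x))) (at t)"
    by (simp add: has_vector_derivative_def)
  moreover have "(V has_derivative V' y) (at ((T - t) powr (- b) *\<^sub>R x))"
    using V[of y] y by (simp add: \<tau>_def)
  ultimately have "((\<lambda>s. V ((T - s) powr (- b) *\<^sub>R x)) has_derivative
      (\<lambda>h. V' y (h *\<^sub>R ((b * \<tau> powr (- b) / \<tau>) *\<^sub>R x)))) (at t)"
    by (rule has_derivative_compose)
  moreover have "V' y (h *\<^sub>R ((b * \<tau> powr (- b) / \<tau>) *\<^sub>R x)) = h *\<^sub>R ((b / \<tau>) *\<^sub>R V' y y)" for h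
  proof -
    have "h *\<^sub>R ((b * \<tau> powr (- b) / \<tau>) *\<^sub>R x) = (h * (b / \<tau>)) *\<^sub>R y"
      by (subst y) (simp add: ac_simps)
    then show ?thesis using lin by (simp only: linear_cmul) simp
  qed
  ultimately have "((\<lambda>s. V ((T - s) powr (- b) *\<^sub>R x)) has_vector_derivative (b / \<tau>) *\<^sub>R V' y y) (at t)"
    by (simp add: has_vector_derivative_def)
  from has_vector_derivative_scaleR[OF pw[of a] this]
  have "((\<lambda>s. (T - s) powr (- a) *\<^sub>R V ((T - s) powr (- b) *\<^sub>R x)) has_vector_derivative
      (\<tau> powr (- a) / \<tau>) *\<^sub>R (a *\<^sub>R V y + b *\<^sub>R V' y y)) (at t)"
    using y by (simp add: \<tau>_def[symmetric] scaleR_add_right ac_simps)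
  then have "((\<lambda>s. v x s) has_vector_derivative (\<tau> powr (- a) / \<tau>) *\<^sub>R (a *\<^sub>R V y + b *\<^sub>R V' y y)) (at t)"
    by (rule has_vector_derivative_transform_within_open[where S = "{0<..<T}"]) (use t v in auto)
  then have vt: "vector_derivative (\<lambda>s. v x s) (at t) = (\<tau> powr (- a) / \<tau>) *\<^sub>R (a *\<^sub>R V y + b *\<^sub>R V' y y)"
    by (rule vector_derivative_at)
  have vx: "v x t = \<tau> powr (- a) *\<^sub>R V y"
    using v[of t x] t y by (simp add: \<tau>_def)
  obtain D where D: "\<And>x. ((\<lambda>y. v y t) has_derivative D x) (at x)"
  proof -
    obtain G :: "real \<Rightarrow> (real^3) \<Rightarrow>\<^sub>C ((real^3) \<Rightarrow>\<^sub>L (real^3))" where "continuous_on {0..<T} G"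
      and G: "\<forall>s\<in>{0..<T}. \<forall>x. ((\<lambda>y. v y s) has_derivative blinfun_apply (apply_bcontfun (G s) x)) (at x)"
      using euler_solution_gradient[OF euler] by blast
    have "t \<in> {0..<T}" using t by simp
    then show ?thesis using G by (intro that[of "\<lambda>x. blinfun_apply (apply_bcontfun (G t) x)"]) blast
  qed
  have V'D: "V' y h = \<tau> *\<^sub>R D x h" for h
    using has_derivative_unique[OF V[of y] self_similar_profile_has_derivative[OF \<alpha> ss t D]]
    unfolding x_def \<tau>_def b_def by (simp add: fun_eq_iff)
  have "convective (\<lambda>y. v y t) (\<lambda>y. v y t) x = D x (v x t)"
    unfolding convective_def partial_deriv_eq[OF D]
    by (rule linear_axis_expansion[OF has_derivative_linear[OF D], symmetric])
  also have "\<dots> = (1 / \<tau>) *\<^sub>R V' y (v x t)" using V'D \<tau> by simp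
  also have "\<dots> = (\<tau> powr (- a) / \<tau>) *\<^sub>R V' y (V y)"
    unfolding vx using lin by (simp add: linear_cmul)
  finally have conv: "convective (\<lambda>y. v y t) (\<lambda>y. v y t) x = (\<tau> powr (- a) / \<tau>) *\<^sub>R V' y (V y)" .
  have "vector_derivative (\<lambda>s. v x s) (at t) + convective (\<lambda>y. v y t) (\<lambda>y. v y t) x
      = - grad (\<lambda>y. p y t) x"
    using euler t unfolding euler_solution_def by auto
  then have "(\<tau> powr (- a) / \<tau>) *\<^sub>R (a *\<^sub>R V y + b *\<^sub>R V' y y + V' y (V y)) = - grad (\<lambda>y. p y t) x"
    unfolding vt conv by (simp add: scaleR_add_right)
  then have "(\<tau> * \<tau> powr a) *\<^sub>R ((\<tau> powr (- a) / \<tau>) *\<^sub>R (a *\<^sub>R V y + b *\<^sub>R V' y y + V' y (V y)))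
      = - ((\<tau> * \<tau> powr a) *\<^sub>R grad (\<lambda>y. p y t) x)"
    by simp
  moreover have "(\<tau> * \<tau> powr a) * (\<tau> powr (- a) / \<tau>) = 1"
    using \<tau> by (simp add: powr_minus field_simps)
  ultimately have "a *\<^sub>R V y + b *\<^sub>R V' y y + V' y (V y) = - ((\<tau> * \<tau> powr a) *\<^sub>R grad (\<lambda>y. p y t) x)"
    by (metis scaleR_one scaleR_scaleR)
  moreover have "V' y (V y + b *\<^sub>R y) = V' y (V y) + b *\<^sub>R V' y y"
    using lin by (simp add: linear_add linear_cmul)
  ultimately show ?thesis unfolding x_def by (simp add: algebra_simps)
qed

text \<open>The profile satisfies the hypotheses of \<open>vorticity_transport\<close> with \<open>W = V + b y\<close>, \<open>c = a - b\<close> and \<open>d = 3 b\<close>. In three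
  dimensions \<open>vort_sq\<close> is twice the square of the length of the curl, so the integrability assumption for \<open>p\<close> near
  zero is the one of \<open>vort_sq_eq_0\<close> with \<open>q = p / 2\<close>.\<close>

lemma profile_irrotational:
  fixes V :: "real^3 \<Rightarrow> real^3"
  assumes \<alpha>: "\<alpha> \<noteq> -1" and "T > 0" and euler: "euler_solution T v0 v p" and ss: "self_similar \<alpha> T V v"
    and "p1 > 0" and Lp: "\<And>q. q \<in> {0<..<p1} \<Longrightarrow> in_Lp q (curl V)"
  shows "\<exists>V'. \<forall>y. (V has_derivative V' y) (at y) \<and> (\<forall>i j. V' y (axis i 1) $ j = V' y (axis j 1) $ i)"
proof -
  obtain G :: "real \<Rightarrow> (real^3) \<Rightarrow>\<^sub>C ((real^3) \<Rightarrow>\<^sub>L (real^3))" where "continuous_on {0..<T} G"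
    and G': "\<forall>t\<in>{0..<T}. \<forall>x. ((\<lambda>y. v y t) has_derivative blinfun_apply (apply_bcontfun (G t) x)) (at x)"
    using euler_solution_gradient[OF euler] by blast
  have G: "((\<lambda>y. v y t) has_derivative blinfun_apply (apply_bcontfun (G t) x)) (at x)" if "t \<in> {0..<T}" for t x
    using G' that by blast
  define a b where "a = \<alpha> / (\<alpha> + 1)" and "b = 1 / (\<alpha> + 1)"
  have ab: "a + b = 1" "b \<noteq> 0" using \<alpha> by (auto simp: a_def b_def field_simps)
  define t where "t = T / 2"
  have t: "0 < t" "t < T" "t \<in> {0..<T}" using \<open>T > 0\<close> by (auto simp: t_def)
  define \<tau> where "\<tau> = T - t"
  have \<tau>: "\<tau> > 0" using t by (simp add: \<tau>_def)
  define D where "D = (\<lambda>x. blinfun_apply (apply_bcontfun (G t) x))"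
  have D: "((\<lambda>y. v y t) has_derivative D x) (at x)" for x
    unfolding D_def by (rule G[OF t(3)])
  define V' where "V' = (\<lambda>y h. \<tau> *\<^sub>R D (\<tau> powr b *\<^sub>R y) h)"
  have V: "(V has_derivative V' y) (at y)" for y
    using self_similar_profile_has_derivative[OF \<alpha> ss t(1,2) D] unfolding V'_def \<tau>_def b_def .
  define W where "W = (\<lambda>y. V y + b *\<^sub>R y)"
  define W' where "W' = (\<lambda>y h. V' y h + b *\<^sub>R h)"
  define L where "L = \<tau> * norm (G t) + \<bar>b\<bar>"
  define P where "P = (\<lambda>y. (\<tau> * \<tau> powr a / \<tau> powr b) * p (\<tau> powr b *\<^sub>R y) t)"
  \<comment> \<open>the Bernoulli-type function \<open>P + |V|\<^sup>2/2 + b y \<cdot> V\<close>, where \<open>P\<close> is the pressure in self-similar variables\<close>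
  define Q where "Q = (\<lambda>y. P y + (1 / 2 * (\<Sum>j\<in>UNIV. V y $ j * V y $ j) + b * (\<Sum>j\<in>UNIV. y $ j * V y $ j)))"
  have cV': "continuous_on UNIV (\<lambda>y. V' y (axis i 1) $ j)" for i j
    unfolding V'_def D_def
    by (intro continuous_intros continuous_on_compose2[OF continuous_on_apply_bcontfun[of UNIV "G t"]]) auto
  have bV': "norm (V' y h) \<le> \<tau> * norm (G t) * norm h" for y h
  proof -
    have "norm (D x h) \<le> norm (G t) * norm h" for x
      unfolding D_def
      by (rule order_trans[OF norm_blinfun]) (intro mult_right_mono norm_bounded norm_ge_zero)
    then show ?thesis unfolding V'_def using \<tau> by (simp add: mult.assoc)
  qed
  have p: "(\<lambda>y. p y t) differentiable (at x)" for x
    using euler t unfolding euler_solution_def by auto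
  have P: "has_partial P i (\<lambda>y. \<tau> * \<tau> powr a * grad (\<lambda>y. p y t) (\<tau> powr b *\<^sub>R y) $ i)" for i
    unfolding has_partial_def
  proof
    fix y
    obtain p' where p': "((\<lambda>y. p y t) has_derivative p') (at (\<tau> powr b *\<^sub>R y))"
      using p unfolding differentiable_def by blast
    have "((\<lambda>s. \<tau> powr b *\<^sub>R (y + s *\<^sub>R axis i 1)) has_derivative (\<lambda>s. \<tau> powr b *\<^sub>R (s *\<^sub>R axis i 1))) (at (0::real))"
      by (auto intro!: derivative_eq_intros)
    moreover have "((\<lambda>y. p y t) has_derivative p') (at (\<tau> powr b *\<^sub>R (y + 0 *\<^sub>R axis i 1)))"
      using p' by simp
    ultimately have "((\<lambda>s. p (\<tau> powr b *\<^sub>R (y + s *\<^sub>R axis i 1)) t) has_derivative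
        (\<lambda>s. p' (\<tau> powr b *\<^sub>R (s *\<^sub>R axis i 1)))) (at 0)"
      by (rule has_derivative_compose)
    moreover have "(\<lambda>s. p' (\<tau> powr b *\<^sub>R (s *\<^sub>R axis i 1))) = (*) (\<tau> powr b * p' (axis i 1))"
      using has_derivative_linear[OF p'] by (auto simp: linear_cmul)
    ultimately have "((\<lambda>s. p (\<tau> powr b *\<^sub>R (y + s *\<^sub>R axis i 1)) t) has_real_derivative
        \<tau> powr b * p' (axis i 1)) (at 0)"
      by (simp add: has_field_derivative_def)
    from DERIV_cmult[OF this, of "\<tau> * \<tau> powr a / \<tau> powr b"]
    show "((\<lambda>s. P (y + s *\<^sub>R axis i 1)) has_real_derivative
        \<tau> * \<tau> powr a * grad (\<lambda>y. p y t) (\<tau> powr b *\<^sub>R y) $ i) (at 0)"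
      unfolding P_def grad_def using \<tau> by (simp add: partial_deriv_eq[OF p'] mult.assoc)
  qed
  have cV: "continuous_on UNIV (\<lambda>y. V y $ i)" for i
    using has_derivative_continuous[OF V] by (auto intro!: continuous_intros simp: continuous_on_eq_continuous_at)
  have cP: "continuous_on UNIV P"
  proof -
    have "continuous_on UNIV (\<lambda>y. p y t)"
      using p by (auto simp: continuous_on_eq_continuous_at intro: differentiable_imp_continuous_within)
    then have "continuous_on UNIV (\<lambda>y. p (\<tau> powr b *\<^sub>R y) t)"
      by (rule continuous_on_compose2) (auto intro!: continuous_intros)
    then show ?thesis
      unfolding P_def by (rule continuous_on_mult_left)
  qed
  have lin: "linear (V' y)" for y by (rule has_derivative_linear[OF V])
  interpret vorticity_transport V W V' W' Q "a - b" "3 * b" L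
  proof
    show "(V has_derivative V' x) (at x)" for x by (rule V)
    show "(W has_derivative W' x) (at x)" for x
      unfolding W_def W'_def by (auto intro!: derivative_eq_intros V)
    show "continuous_on UNIV (\<lambda>x. V' x (axis i 1) $ j)" for i j by (rule cV')
    show "continuous_on UNIV (\<lambda>x. W' x (axis i 1) $ j)" for i j
      unfolding W'_def vector_add_component by (rule continuous_on_add[OF cV' continuous_on_const])
    show "norm (V' x h) \<le> L * norm h" for x h
      using bV'[of x h] mult_nonneg_nonneg[OF abs_ge_zero norm_ge_zero, of b h] unfolding L_def distrib_right by linarith
    show "norm (W' x h) \<le> L * norm h" for x h
      using bV'[of x h] norm_triangle_ineq[of "V' x h" "b *\<^sub>R h"] unfolding L_def W'_def by (simp add: distrib_right)
    show "(\<Sum>i\<in>UNIV. W' x (axis i 1) $ i) = 3 * b" for x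
    proof -
      have "divergence (\<lambda>y. v y t) (\<tau> powr b *\<^sub>R x) = 0"
        using euler t unfolding euler_solution_def by auto
      then have "(\<Sum>i\<in>UNIV. D (\<tau> powr b *\<^sub>R x) (axis i 1) $ i) = 0"
        unfolding divergence_def partial_deriv_component_eq[OF D] .
      then have "(\<Sum>i\<in>UNIV. V' x (axis i 1) $ i) = 0"
        unfolding V'_def by (simp add: sum_distrib_left[symmetric])
      then show ?thesis unfolding W'_def by (simp add: sum.distrib)
    qed
    show "continuous_on UNIV Q"
      unfolding Q_def by (intro continuous_intros cP cV)
    show "has_partial Q i (\<lambda>x. - ((a - b) * V x $ i
        + (\<Sum>j\<in>UNIV. W x $ j * (V' x (axis j 1) $ i - V' x (axis i 1) $ j))))" for i
    proof -
      have Vp: "has_partial (\<lambda>y. V y $ j) i (\<lambda>y. V' y (axis i 1) $ j)" for j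
        by (rule has_partial_component[OF V])
      have "has_partial Q i (\<lambda>y. \<tau> * \<tau> powr a * grad (\<lambda>y. p y t) (\<tau> powr b *\<^sub>R y) $ i
         + (1 / 2 * (\<Sum>j\<in>UNIV. V' y (axis i 1) $ j * V y $ j + V y $ j * V' y (axis i 1) $ j)
            + b * (\<Sum>j\<in>UNIV. (if j = i then 1 else 0) * V y $ j + y $ j * V' y (axis i 1) $ j)))"
        unfolding Q_def
        by (intro has_partial_add P has_partial_cmult has_partial_sum has_partial_mult Vp has_partial_coordinate)
      moreover have "\<tau> * \<tau> powr a * grad (\<lambda>y. p y t) (\<tau> powr b *\<^sub>R y) $ i
         + (1 / 2 * (\<Sum>j\<in>UNIV. V' y (axis i 1) $ j * V y $ j + V y $ j * V' y (axis i 1) $ j)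
            + b * (\<Sum>j\<in>UNIV. (if j = i then 1 else 0) * V y $ j + y $ j * V' y (axis i 1) $ j))
         = - ((a - b) * V y $ i + (\<Sum>j\<in>UNIV. W y $ j * (V' y (axis j 1) $ i - V' y (axis i 1) $ j)))" for y
      proof -
        have "a *\<^sub>R V y + V' y (W y) = - ((\<tau> * \<tau> powr a) *\<^sub>R grad (\<lambda>x. p x t) (\<tau> powr b *\<^sub>R y))"
          using profile_equation[OF \<alpha> euler ss t(1,2) V, of y]
          unfolding W_def \<tau>_def a_def b_def .
        then have "(a *\<^sub>R V y + V' y (W y)) $ i = (- ((\<tau> * \<tau> powr a) *\<^sub>R grad (\<lambda>x. p x t) (\<tau> powr b *\<^sub>R y))) $ i"
          by (rule arg_cong)
        then have gp: "\<tau> * \<tau> powr a * grad (\<lambda>y. p y t) (\<tau> powr b *\<^sub>R y) $ i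
           = - (a * V y $ i) - (\<Sum>j\<in>UNIV. W y $ j * V' y (axis j 1) $ i)"
          using linear_axis_expansion[OF lin, of y "W y"] by simp
        have "(\<Sum>j\<in>UNIV. W y $ j * V' y (axis i 1) $ j) =
           1 / 2 * (\<Sum>j\<in>UNIV. V' y (axis i 1) $ j * V y $ j + V y $ j * V' y (axis i 1) $ j)
           + b * (\<Sum>j\<in>UNIV. y $ j * V' y (axis i 1) $ j)"
          unfolding W_def by (simp add: sum_distrib_left sum.distrib[symmetric] algebra_simps)
        moreover have "(\<Sum>j\<in>UNIV. (if j = i then 1 else 0) * V y $ j) = V y $ i"
          by (subst sum.cong[OF refl, of _ _ "\<lambda>j. if j = i then V y $ j else 0"]) auto
        ultimately show ?thesis
          unfolding gp sum.distrib by (simp add: sum.distrib sum_subtractf right_diff_distrib distrib_left left_diff_distrib)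
      qed
      ultimately show ?thesis by (simp only:)
    qed
  qed
  have norm_curl: "vort_sq x = 2 * (norm (curl V x))\<^sup>2" for x
    unfolding curl_eq[OF V] vort_sq_def vort_def power2_norm_eq_inner inner_vec_def
    by (simp add: sum_3 vector_3 power2_eq_square algebra_simps)
  have "integrable lborel (\<lambda>x. vort_sq x powr q)" if q: "0 < q" "q < p1 / 2" for q
  proof (rule integrableI_bounded)
    show "(\<lambda>x. vort_sq x powr q) \<in> borel_measurable lborel"
      using borel_measurable_lborel_continuous[OF continuous_vort_sq] by measurable
    have in_Lp: "in_Lp (2 * q) (curl V)" using q by (intro Lp) auto
    then have [measurable]: "curl V \<in> borel_measurable lebesgue" by (simp add: in_Lp_def)
    have eq: "vort_sq x powr q = 2 powr q * norm (curl V x) powr (2 * q)" for x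
      unfolding norm_curl by (simp add: powr_mult powr_powr[symmetric] powr_realpow[symmetric] flip: powr_numeral)
    have "(\<integral>\<^sup>+ x. ennreal (norm (vort_sq x powr q)) \<partial>lborel)
        = (\<integral>\<^sup>+ x. ennreal (2 powr q) * ennreal (norm (curl V x) powr (2 * q)) \<partial>lebesgue)"
      unfolding eq nn_integral_completion by (simp add: ennreal_mult)
    also have "\<dots> = ennreal (2 powr q) * (\<integral>\<^sup>+ x. ennreal (norm (curl V x) powr (2 * q)) \<partial>lebesgue)"
      by (rule nn_integral_cmult) measurable
    also have "\<dots> < \<infinity>"
      using in_Lp unfolding in_Lp_def by (simp add: ennreal_mult_less_top)
    finally show "(\<integral>\<^sup>+ x. ennreal (norm (vort_sq x powr q)) \<partial>lborel) < \<infinity>" .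
  qed
  then have "vort_sq x = 0" for x
    using ab(2) \<open>p1 > 0\<close> by (intro vort_sq_eq_0[of "p1 / 2"]) auto
  then have "vort i j x = 0" for i j x
    unfolding vort_sq_def by (simp add: sum_nonneg_eq_0_iff sum_nonneg)
  then have "V' y (axis i 1) $ j = V' y (axis j 1) $ i" for y i j
    unfolding vort_def by simp
  then show ?thesis using V by blast
qed

text \<open>For \<open>0 < t < T\<close> the gradient of \<open>v\<close> is a multiple of that of \<open>V\<close>, hence symmetric, and the vorticity vanishes. The
  self-similar form says nothing about \<open>t = 0\<close>; there the symmetry follows from the continuity of the gradient in time.\<close>

theorem theorem1p1:
  fixes \<alpha> T :: real and V \<Omega> :: "real^3 \<Rightarrow> real^3"
  assumes "\<alpha> \<noteq> -1"
    and "T > 0"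
    and "\<Omega> = curl V"
    and "\<exists>p1>0. \<forall>p\<in>{0<..<p1}. in_Lp p \<Omega>"
  shows "\<not> (\<exists>v v0 p. euler_solution T v0 v p \<and> self_similar \<alpha> T V v \<and> blows_up_at T v)"
proof (intro notI, elim exE conjE)
  fix v v0 p
  assume euler: "euler_solution T v0 v p" and ss: "self_similar \<alpha> T V v" and blowup: "blows_up_at T v"
  obtain p1 where "p1 > 0" "\<And>q. q \<in> {0<..<p1} \<Longrightarrow> in_Lp q (curl V)"
    using assms(3,4) by blast
  then obtain V' where V: "\<And>y. (V has_derivative V' y) (at y)"
    and sym: "\<And>y i j. V' y (axis i 1) $ j = V' y (axis j 1) $ i"
    using profile_irrotational[OF assms(1,2) euler ss] by blast
  obtain G :: "real \<Rightarrow> (real^3) \<Rightarrow>\<^sub>C ((real^3) \<Rightarrow>\<^sub>L (real^3))" where cG: "continuous_on {0..<T} G"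
    and G': "\<forall>t\<in>{0..<T}. \<forall>x. ((\<lambda>y. v y t) has_derivative blinfun_apply (apply_bcontfun (G t) x)) (at x)"
    using euler_solution_gradient[OF euler] by blast
  have G: "((\<lambda>y. v y t) has_derivative blinfun_apply (apply_bcontfun (G t) x)) (at x)" if "t \<in> {0..<T}" for t x
    using G' that by blast
  define A where "A = (\<lambda>t x i j. blinfun_apply (apply_bcontfun (G t) x) (axis i 1) $ j
      - blinfun_apply (apply_bcontfun (G t) x) (axis j 1) $ i)"
  have A_pos: "A t x i j = 0" if t: "t \<in> {0<..<T}" for t x i j
  proof -
    let ?y = "x /\<^sub>R (T - t) powr (1 / (\<alpha> + 1))"
    have "V' ?y = (\<lambda>h. (T - t) *\<^sub>R blinfun_apply (apply_bcontfun (G t) ((T - t) powr (1 / (\<alpha> + 1)) *\<^sub>R ?y)) h)"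
      using t by (intro has_derivative_unique[OF V self_similar_profile_has_derivative[OF assms(1) ss]] G) auto
    then have "V' ?y = (\<lambda>h. (T - t) *\<^sub>R blinfun_apply (apply_bcontfun (G t) x) h)"
      using t by simp
    with sym[of ?y i j] t show ?thesis unfolding A_def by simp
  qed
  have A0: "A 0 x i j = 0" for x i j
  proof -
    have "continuous_on {0..T/2} (\<lambda>t. A t x i j)"
    proof -
      have "continuous_on {0..T/2} G" using cG by (rule continuous_on_subset) (use assms(2) in auto)
      then have "continuous_on {0..T/2} (\<lambda>t. apply_bcontfun (G t) x)"
        unfolding continuous_on_iff by (meson dist_bounded le_less_trans)
      then show ?thesis unfolding A_def by (intro continuous_intros)
    qed
    then show ?thesis
      by (intro continuous_constant_on_closure[of "{0<..<T/2}" "\<lambda>t. A t x i j" 0 0])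
        (use assms(2) A_pos in auto)
  qed
  have "curl (\<lambda>y. v y t) x = 0" if t: "t \<in> {0..<T}" for t x
  proof -
    have "A t x i j = 0" for i j
      using A_pos[of t x i j] A0[of x i j] t by (cases "t = 0") auto
    then show ?thesis
      unfolding curl_eq[OF G[OF t]] A_def by (simp add: vec_eq_iff forall_3 vector_3)
  qed
  then have "(SUP t\<in>{0..<T}. esssup lebesgue (\<lambda>x. ennreal (norm (curl (\<lambda>y. v y t) x)))) \<le> 0"
    by (intro SUP_least esssup_I) auto
  then show False
    using blowup unfolding blows_up_at_def by simp
qed

end
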